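(* Let $(x^t,y^t)_{t\ge1}$ be generated by SPGM-BCD with parameters $\theta_1,\theta_2>0$ and working sets of size $k$ chosen uniformly at random, where $(\mu^t)_{t\ge0}$ is either constant ($\mu^t=\bar\mu$) or diminishing ($\mu^t=\eta/(t+t_0)$). Let $\theta:=\frac{\theta_1}{\mu^1}+\theta_2$, $\mathcal J^{t+1}:=\mathbb E_{\xi^t}[\mathcal J(x^{t+1},y^{t+1};\mu^t)]$ for $t\ge0$ (so $\mathcal J^1=\mathcal J(x^1,y^1;\mu^0)$), and $\Psi^t:=\frac{L_h^2}{2}\big(\frac{(\mu^{t-1})^2}{\mu^t}-\mu^{t-1}\big)$ for $t\ge1$. Then: (a) For all $t\ge1$: $\mathbb E_{\xi^t}\big[\frac\theta2\|x^{t+1}-x^t\|_2^2+\frac1{2\mu^1}\|y^{t+1}-y^t\|_2^2\big]\le\Psi^t+\mathcal J^t-\mathcal J^{t+1}$. (b) For all $T\ge1$: $\mathbb E_{\xi^T}\big[\sum_{t=1}^T\frac\theta2\|x^{t+1}-x^t\|_2^2+\frac1{2\mu^1}\|y^{t+1}-y^t\|_2^2\big]\le C$, where both terms are summed over $t$ and $C:=\mathcal J^1-\mathcal J^{T+1}+\eta L_h^2<\infty$ (for constant $\mu^t$, $\eta>0$ is an arbitrary constant). (c) For every $\epsilon>0$, the algorithm finds, in the sense of expectation, an $\epsilon$-approximate block-$k$ stationary point in at most $\big\lceil\frac{2C}{\epsilon\min(\theta,(\mu^0)^{-1})}\big\rceil=\mathcal O(\epsilon^{-1})$ iterations; that is,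 whenever $T\ge1$ satisfies $T\ge\frac{2C}{\epsilon\min(\theta,(\mu^0)^{-1})}$ (with $C$ as in (b) for this $T$), there is $\bar t\in\{1,\dots,T\}$ such that $\mathbb E_{\xi^{T}}[\mathcal S(x^{\bar t},y^{\bar t};\mu^{\bar t})]\le\epsilon$, where $\mathcal S$ is the block-$k$ stationarity measure, and such a $T$ can be chosen of order $\mathcal O(\epsilon^{-1})$.
   Context: Setting. $A\in\mathbb R^{m\times n}$, $b\in\mathbb R^m$, $s\in\{1,\dots,n\}$; $f:\mathbb R^n\to\mathbb R$ is smooth and convex; $h:\mathbb R^m\to\mathbb R$ is convex, not necessarily smooth. $\|x\|_0$ is the number of nonzero entries; $\|\cdot\|$ is the Euclidean norm for vectors and spectral norm for matrices; $\|x\|_Q:=\sqrt{x^{\mathsf T}Qx}$ for $Q\succeq0$. The problem is $\min_x F(x):=f(x)+h(Ax-b)$ subject to $\|x\|_0\le s$. Standing assumptions. (1) $\|\nabla f(x)\|\le L_f$ for all $\|x\|_0\le s$, and every subgradient of $h$ at every $y\in\mathbb R^m$ has norm at most $L_h$; $L_F:=L_f+\|A\|L_h$. (2) There are $V_s,M_s>0$ with $\frac{V_s}{2}\|x-x'\|_2^2\le f(x')-f(x)-\langle x'-x,\nabla f(x)\rangle\le\frac{M_s}{2}\|x-x'\|_2^2$ for all $\|x\|_0\le s,\|x'\|_0\le s$, and a symmetric $\tilde M$ with $0\prec V_sI_n\preceq\tilde M\preceq M_sI_n$ and $f(x')-f(x)-\langle x'-x,\nabla f(x)\rangle\le\frac12\|x-x'\|_{\tilde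 M}^2$ for all such $x,x'$. (3) There is $A_s>0$ with $\|A(x-x')\|\le A_s\|x-x'\|$ for all $\|x\|_0\le s,\|x'\|_0\le s$. Notation. $\delta(x)=0$ if $\|x\|_0\le s$ and $+\infty$ otherwise; $\mathcal R(x,y;\mu):=f(x)+\frac1{2\mu}\|Ax-b-y\|_2^2$; $\mathcal J(x,y;\mu):=\mathcal R(x,y;\mu)+h(y)+\delta(x)$; $\mathbb P_\mu(c):=\arg\min_y h(y)+\frac1{2\mu}\|c-y\|_2^2$. $\Omega_n^k$ is the set of all $C_n^k=\binom nk$ size-$k$ subsets $B$ of $\{1,\dots,n\}$, $B^c$ is the complement, $U_B\in\mathbb R^{n\times k}$ is the matrix whose columns are the standard basis vectors indexed by $B$ (so $x_B=U_B^{\mathsf T}x$ and $x=U_Bx_B+U_{B^c}x_{B^c}$). $\ddot{\mathcal M}(x,x',y;\mu):=\mathcal R(x',y;\mu)+\langle x-x',\nabla_x\mathcal R(x',y;\mu)\rangle+\frac12\|x-x'\|^2_{(A^{\mathsf T}A+\theta_1I_n)/\mu+\tilde M+\theta_2I_n}$. SPGM-BCD. Let $2\le k\le n$, $\theta_1,\theta_2>0$, $x^1$ with $\|x^1\|_0\le s$, $y^1=\mathbb P_{\mu^0}(Ax^1-b)$. For $t=1,2,\dots$: draw $B^t\in\Omega_n^k$ uniformly at random, independently of the past; take a global minimizer $x^{t+1}\in\arg\min\{\ddot{\mathcal M}(x,x^t,y^t;\mu^t):\|x\|_0\le s,\ x_{(B^t)^c}=x^t_{(B^t)^c}\}$; set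 $y^{t+1}=\mathbb P_{\mu^t}(Ax^{t+1}-b)$. Put $\xi^t:=\{B^1,\dots,B^t\}$; $(x^t,y^t)$ depends on $\xi^{t-1}$, and $\mathbb E_{\xi^t}$ is expectation over $\xi^t$. The parameters are either $\mu^t=\bar\mu$ for all $t$ ($\bar\mu>0$ a sufficiently small constant), or $\mu^t=\frac\eta{t+t_0}$ with constants $\eta>0$, $t_0\ge1$. Definition. Define the block-$k$ stationarity measure $$\mathcal S(x,y;\mu):=\mathrm{dist}^2\big(y,\arg\min_{y'}\mathcal J(x,y';\mu)\big)+\tfrac1{C_n^k}\sum_{B\in\Omega_n^k}\mathrm{dist}^2\big(x_B,\arg\min_{z_B\in\mathbb R^k}\{\delta(U_Bz_B+U_{B^c}x_{B^c})+\ddot{\mathcal M}(U_Bz_B+U_{B^c}x_{B^c},x,y;\mu)\}\big),$$ with $\mathrm{dist}^2$ the squared Euclidean distance. For $\epsilon>0$ and (sufficiently small) $\mu>0$, $(\ddot x,\ddot y)$ is an $\epsilon$-approximate block-$k$ stationary point if $\mathcal S(\ddot x,\ddot y;\mu)\le\epsilon$. *)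

theory Defs
  imports "HOL-Probability.Probability" "HOL-Library.Landau_Symbols"
begin

section \<open>Sparsity, gradients, minimizers\<close>

definition nnz :: "real^'n \<Rightarrow> nat" where
  "nnz x = card {i. x $ i \<noteq> 0}"

definition gradient :: "('a::real_inner \<Rightarrow> real) \<Rightarrow> 'a \<Rightarrow> 'a" where
  "gradient g x = (THE D. GDERIV g x :> D)"

text \<open>``Smooth'' means continuously differentiable.\<close>

definition smooth_fun :: "('a::real_inner \<Rightarrow> real) \<Rightarrow> bool" where
  "smooth_fun g \<longleftrightarrow> (\<forall>x. \<exists>D. GDERIV g x :> D) \<and> continuous_on UNIV (gradient g)"

definition subdifferential :: "('a::real_inner \<Rightarrow> real) \<Rightarrow> 'a \<Rightarrow> 'a set" where
  "subdifferential g y = {v. \<forall>z. g y + v \<bullet> (z - y) \<le> g z}"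

definition psd :: "real^'n^'n \<Rightarrow> bool" where
  "psd Q \<longleftrightarrow> transpose Q = Q \<and> (\<forall>v. 0 \<le> v \<bullet> (Q *v v))"

definition loewner_le :: "real^'n^'n \<Rightarrow> real^'n^'n \<Rightarrow> bool" where
  "loewner_le P Q \<longleftrightarrow> psd (Q - P)"

definition norm_Q :: "real^'n^'n \<Rightarrow> real^'n \<Rightarrow> real" where
  "norm_Q Q x = sqrt (x \<bullet> (Q *v x))"

definition argmins :: "('a \<Rightarrow> 'b::linorder) \<Rightarrow> 'a set \<Rightarrow> 'a set" where
  "argmins g S = {z. is_arg_min g (\<lambda>w. w \<in> S) z}"

text \<open>Squared distance to a set, with the convention that the distance to the empty
  set is infinite (unlike \<^const>\<open>infdist\<close>, for which it is 0).\<close>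

definition dist2 :: "'a::metric_space \<Rightarrow> 'a set \<Rightarrow> ennreal" where
  "dist2 z S = (INF w\<in>S. ennreal ((dist z w)\<^sup>2))"


section \<open>The penalized problem\<close>

definition sparse_ind :: "nat \<Rightarrow> real^'n \<Rightarrow> ereal" where
  "sparse_ind s x = (if nnz x \<le> s then 0 else \<infinity>)"

definition Rfun :: "(real^'n \<Rightarrow> real) \<Rightarrow> real^'n^'m \<Rightarrow> real^'m
    \<Rightarrow> real^'n \<Rightarrow> real^'m \<Rightarrow> real \<Rightarrow> real" where
  "Rfun f A b x y \<mu> = f x + 1 / (2 * \<mu>) * (norm (A *v x - b - y))\<^sup>2"

definition Jfun :: "(real^'n \<Rightarrow> real) \<Rightarrow> (real^'m \<Rightarrow> real) \<Rightarrow> real^'n^'m \<Rightarrow> real^'m \<Rightarrow> nat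
    \<Rightarrow> real^'n \<Rightarrow> real^'m \<Rightarrow> real \<Rightarrow> ereal" where
  "Jfun f h A b s x y \<mu> = ereal (Rfun f A b x y \<mu>) + ereal (h y) + sparse_ind s x"

text \<open>The set of minimizers defining the proximal point; for convex \<open>h\<close> and \<open>\<mu> > 0\<close> it is
  a singleton.\<close>

definition prox :: "(real^'m \<Rightarrow> real) \<Rightarrow> real \<Rightarrow> real^'m \<Rightarrow> (real^'m) set" where
  "prox h \<mu> c = argmins (\<lambda>y. h y + 1 / (2 * \<mu>) * (norm (c - y))\<^sup>2) UNIV"

definition major :: "(real^'n \<Rightarrow> real) \<Rightarrow> real^'n^'m \<Rightarrow> real^'m \<Rightarrow> real^'n^'n \<Rightarrow> real \<Rightarrow> real
    \<Rightarrow> real^'n \<Rightarrow> real^'n \<Rightarrow> real^'m \<Rightarrow> real \<Rightarrow> real" where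
  "major f A b Mt \<theta>1 \<theta>2 x x' y \<mu> =
     Rfun f A b x' y \<mu> + (x - x') \<bullet> gradient (\<lambda>u. Rfun f A b u y \<mu>) x'
     + 1 / 2 * (norm_Q ((1 / \<mu>) *\<^sub>R (transpose A ** A + \<theta>1 *\<^sub>R mat 1) + Mt + \<theta>2 *\<^sub>R mat 1)
                       (x - x'))\<^sup>2"


section \<open>Working sets and the block stationarity measure\<close>

definition working_sets :: "nat \<Rightarrow> 'n::finite set set" where
  "working_sets k = {B. card B = k}"

text \<open>A block vector with index set \<open>B\<close> is represented in the full space by its extension by
  zero, that is, the coordinate space of dimension \<open>card B\<close> is identified with
  \<open>block_space B\<close> through the isometry \<open>z \<mapsto> U\<^sub>B z\<close>. Accordingly \<open>block B x\<close> stands both for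
  the block \<open>x\<^sub>B\<close> and for the vector \<open>U\<^sub>B x\<^sub>B\<close>.\<close>

definition block_space :: "'n set \<Rightarrow> (real^'n) set" where
  "block_space B = {z. \<forall>i. i \<notin> B \<longrightarrow> z $ i = 0}"

definition block :: "'n set \<Rightarrow> real^'n \<Rightarrow> real^'n" where
  "block B x = (\<chi> i. if i \<in> B then x $ i else 0)"

definition stationarity :: "(real^'n \<Rightarrow> real) \<Rightarrow> (real^'m \<Rightarrow> real) \<Rightarrow> real^'n^'m \<Rightarrow> real^'m \<Rightarrow> nat
    \<Rightarrow> real^'n^'n \<Rightarrow> real \<Rightarrow> real \<Rightarrow> nat \<Rightarrow> real^'n \<Rightarrow> real^'m \<Rightarrow> real \<Rightarrow> ennreal" where
  "stationarity f h A b s Mt \<theta>1 \<theta>2 k x y \<mu> =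
     dist2 y (argmins (\<lambda>y'. Jfun f h A b s x y' \<mu>) UNIV)
     + 1 / of_nat (CARD('n) choose k) *
       (\<Sum>B\<in>working_sets k.
          dist2 (block B x)
            (argmins (\<lambda>z. sparse_ind s (z + block (- B) x)
                          + ereal (major f A b Mt \<theta>1 \<theta>2 (z + block (- B) x) x y \<mu>))
                     (block_space B)))"


section \<open>The algorithm\<close>

text \<open>\<open>B t\<close>, \<open>x t\<close>, \<open>y t\<close> for \<open>t \<ge> 1\<close> are random variables on \<open>M\<close>. The last conjunct says that
  \<open>(x t, y t)\<close> is a function of \<open>B 1, \<dots>, B (t - 1)\<close>: ties between several minimizers are
  broken by a rule depending on the history only. Hence the expectation over the
  working sets drawn so far is the expectation with respect to \<open>M\<close>.\<close>

definition spgm_bcd :: "'w measure \<Rightarrow> (real^'n \<Rightarrow> real) \<Rightarrow> (real^'m \<Rightarrow> real) \<Rightarrow> real^'n^'m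
    \<Rightarrow> real^'m \<Rightarrow> nat \<Rightarrow> real^'n^'n \<Rightarrow> real \<Rightarrow> real \<Rightarrow> nat \<Rightarrow> (nat \<Rightarrow> real) \<Rightarrow> real^'n
    \<Rightarrow> (nat \<Rightarrow> 'w \<Rightarrow> 'n set) \<Rightarrow> (nat \<Rightarrow> 'w \<Rightarrow> real^'n) \<Rightarrow> (nat \<Rightarrow> 'w \<Rightarrow> real^'m) \<Rightarrow> bool" where
  "spgm_bcd M f h A b s Mt \<theta>1 \<theta>2 k \<mu> x1 B x y \<longleftrightarrow>
     prob_space M \<and>
     prob_space.indep_vars M (\<lambda>_. count_space UNIV) B {1..} \<and>
     (\<forall>t\<ge>1. distr M (count_space UNIV) (B t) = measure_pmf (pmf_of_set (working_sets k))) \<and>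
     nnz x1 \<le> s \<and>
     (\<forall>\<omega>\<in>space M.
        x 1 \<omega> = x1 \<and>
        y 1 \<omega> \<in> prox h (\<mu> 0) (A *v x1 - b) \<and>
        (\<forall>t\<ge>1.
           x (t + 1) \<omega> \<in> argmins (\<lambda>z. major f A b Mt \<theta>1 \<theta>2 z (x t \<omega>) (y t \<omega>) (\<mu> t))
                              {z. nnz z \<le> s \<and> (\<forall>i. i \<notin> B t \<omega> \<longrightarrow> z $ i = x t \<omega> $ i)} \<and>
           y (t + 1) \<omega> \<in> prox h (\<mu> t) (A *v x (t + 1) \<omega> - b))) \<and>
     (\<forall>t\<ge>1. \<forall>\<omega>\<in>space M. \<forall>\<omega>'\<in>space M.
        (\<forall>i\<in>{1..<t}. B i \<omega> = B i \<omega>') \<longrightarrow> x t \<omega> = x t \<omega>' \<and> y t \<omega> = y t \<omega>')"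

text \<open>The mean merit value \<open>J\<^sup>t\<close>, with the penalty parameter of the preceding step. The
  conversion to reals loses nothing: all iterates are sparse, so the value is finite.\<close>

definition mean_merit :: "'w measure \<Rightarrow> (real^'n \<Rightarrow> real) \<Rightarrow> (real^'m \<Rightarrow> real) \<Rightarrow> real^'n^'m
    \<Rightarrow> real^'m \<Rightarrow> nat \<Rightarrow> (nat \<Rightarrow> real) \<Rightarrow> (nat \<Rightarrow> 'w \<Rightarrow> real^'n) \<Rightarrow> (nat \<Rightarrow> 'w \<Rightarrow> real^'m)
    \<Rightarrow> nat \<Rightarrow> real" where
  "mean_merit M f h A b s \<mu> x y t =
     (\<integral>\<omega>. real_of_ereal (Jfun f h A b s (x t \<omega>) (y t \<omega>) (\<mu> (t - 1))) \<partial>M)"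

definition Psi :: "real \<Rightarrow> (nat \<Rightarrow> real) \<Rightarrow> nat \<Rightarrow> real" where
  "Psi Lh \<mu> t = Lh\<^sup>2 / 2 * ((\<mu> (t - 1))\<^sup>2 / \<mu> t - \<mu> (t - 1))"

text \<open>The constant \<open>C\<close> for the horizon \<open>T\<close>.\<close>

definition Cconst :: "'w measure \<Rightarrow> (real^'n \<Rightarrow> real) \<Rightarrow> (real^'m \<Rightarrow> real) \<Rightarrow> real^'n^'m
    \<Rightarrow> real^'m \<Rightarrow> nat \<Rightarrow> (nat \<Rightarrow> real) \<Rightarrow> (nat \<Rightarrow> 'w \<Rightarrow> real^'n) \<Rightarrow> (nat \<Rightarrow> 'w \<Rightarrow> real^'m)
    \<Rightarrow> real \<Rightarrow> real \<Rightarrow> nat \<Rightarrow> real" where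
  "Cconst M f h A b s \<mu> x y \<eta> Lh T =
     mean_merit M f h A b s \<mu> x y 1 - mean_merit M f h A b s \<mu> x y (T + 1) + \<eta> * Lh\<^sup>2"


section \<open>On the uniform gradient bound\<close>

text \<open>The source also postulates a uniform bound on the gradient of \<open>f\<close> over all sparse vectors.
  It contradicts the restricted strong convexity of \<open>f\<close>, so that with both assumptions
  every statement would hold vacuously. The bound is therefore not assumed.\<close>

lemma gradient_bound_contradicts_strong_convexity:
  fixes f :: "real^'n \<Rightarrow> real" and g :: "real^'n \<Rightarrow> real^'n"
  assumes "V > 0" and "1 \<le> s"
    and sc: "\<And>x x'. nnz x \<le> s \<Longrightarrow> nnz x' \<le> s \<Longrightarrow>
               V / 2 * (norm (x - x'))\<^sup>2 \<le> f x' - f x - (x' - x) \<bullet> g x"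
    and bd: "\<And>x. nnz x \<le> s \<Longrightarrow> norm (g x) \<le> L"
  shows False
proof -
  define r where "r = 2 * \<bar>L\<bar> / V + 1"
  define x :: "real^'n" where "x = axis undefined r"
  have r: "r > 0" using \<open>V > 0\<close> by (simp add: r_def add_nonneg_pos)
  have "{i. x $ i \<noteq> 0} \<subseteq> {undefined}" by (auto simp: x_def axis_def)
  then have "nnz x \<le> card {undefined :: 'n}" unfolding nnz_def by (intro card_mono) auto
  then have x: "nnz x \<le> s" using \<open>1 \<le> s\<close> by simp
  have z: "nnz (0 :: real^'n) \<le> s" by (simp add: nnz_def)
  have nx: "norm x = r" using r by (simp add: x_def norm_eq_sqrt_inner inner_axis_axis)
  have "V * r\<^sup>2 \<le> x \<bullet> (g x - g 0)"
    using sc[OF x z] sc[OF z x] by (simp add: nx inner_diff_right)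
  also have "\<dots> \<le> norm x * norm (g x - g 0)" by (rule norm_cauchy_schwarz)
  also have "\<dots> \<le> r * (2 * \<bar>L\<bar>)"
  proof -
    have "norm (g x - g 0) \<le> norm (g x) + norm (g 0)" by (rule norm_triangle_ineq4)
    then show ?thesis unfolding nx using bd[OF x] bd[OF z] r by (intro mult_left_mono) auto
  qed
  finally have "V * r \<le> 2 * \<bar>L\<bar>" using r by (simp add: power2_eq_square mult.assoc[symmetric])
  then show False using \<open>V > 0\<close> by (simp add: r_def algebra_simps)
qed

end

theory Submission
  imports Defs
begin

text \<open>Why the theorem holds. In one iteration, the majorizer used for the \<open>x\<close>-update exceeds the
  smooth part of the penalized objective by at least a multiple of the squared step, and the old
  iterate is feasible for the subproblem; so the \<open>x\<close>-update lowers the penalized objective by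
  at least \<open>\<theta> / 2\<close> times the squared step. The \<open>y\<close>-update minimizes a function that is strongly convex
  with modulus \<open>1 / \<mu>\<close>, which gives the corresponding gain in \<open>y\<close> (\<open>descent_step\<close>). What is left is
  the increase of the objective caused by lowering the penalty parameter. At a proximal point the
  scaled residual \<open>(c - y) / \<mu>\<close> is a subgradient of \<open>h\<close>, hence bounded by \<open>Lh\<close>, and the increase is
  at most \<open>Psi\<close> (\<open>merit_penalty_change\<close>). All of this holds pathwise; taking expectations gives
  the first claim, and telescoping gives the second.

  For the third claim, the average over all working sets of the distance between a block and its
  block minimizers is the expectation over the set that is actually drawn, because the draw is
  uniform and independent of the history (\<open>uniform_draw_average\<close>). For the drawn set, the next
  iterate is one of the block minimizers, so its gap is at most the squared step. There is one
  further contribution: \<open>y\<close> at step \<open>t\<close> is the proximal point for the previous parameter, while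
  stationarity is measured with the current one. Proximal points move by at most
  \<open>Lh\<close> times the change of the parameter (\<open>prox_parameter_lipschitz\<close>). The sum of these squared
  movements, weighted by \<open>min \<theta> (1 / \<mu> 0) / 2\<close>, together with the sum of all \<open>Psi\<close> stays within the
  budget \<open>\<eta> * Lh\<^sup>2\<close> contained in \<open>C\<close> (\<open>penalty_budget\<close>). Therefore the expected stationarity
  measures of the first \<open>T\<close> iterates add up to at most \<open>2 * C / min \<theta> (1 / \<mu> 0)\<close>, and one of them is at
  most the mean.

  Finally, \<open>C\<close> is bounded independently of \<open>T\<close>, because the penalized objective is
  bounded below on the sparse vectors, uniformly in the penalty parameter
  (\<open>merit_bounded_below\<close>). Hence a horizon of order \<open>1 / \<epsilon>\<close> suffices.\<close>
lemma subdifferential_iff: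
  "v \<in> subdifferential g y \<longleftrightarrow> (\<forall>z. g y + v \<bullet> (z - y) \<le> g z)"
  by (simp add: subdifferential_def)

lemma prox_iff:
  "y \<in> prox h \<mu> c \<longleftrightarrow>
   (\<forall>z. h y + 1 / (2 * \<mu>) * (norm (c - y))\<^sup>2 \<le> h z + 1 / (2 * \<mu>) * (norm (c - z))\<^sup>2)"
  by (auto simp: prox_def argmins_def is_arg_min_linorder)

text \<open>Compare \<open>y\<close> with a point of the segment towards \<open>z\<close>: by convexity, \<open>h\<close> grows at most linearly
  along it, while the quadratic term differs from its linear part only to second order. Dividing by
  the step length and letting it tend to 0 leaves the subgradient inequality.\<close>
lemma prox_subgradient:
  assumes h: "convex_on UNIV h" and \<mu>: "\<mu> > 0" and y: "y \<in> prox h \<mu> c"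
  shows "(1 / \<mu>) *\<^sub>R (c - y) \<in> subdifferential h y"
  unfolding subdifferential_iff
proof
  fix z
  define d where "d = z - y"
  have *: "(c - y) \<bullet> d / \<mu> - l / (2 * \<mu>) * (norm d)\<^sup>2 \<le> h z - h y" if l: "0 < l" "l \<le> 1" for l
  proof -
    define w where "w = (1 - l) *\<^sub>R y + l *\<^sub>R z"
    have cw: "c - w = (c - y) - l *\<^sub>R d" by (simp add: w_def d_def algebra_simps)
    have "h w \<le> (1 - l) * h y + l * h z"
      unfolding w_def using convex_onD[OF h, of l y z] l by simp
    moreover have "h y + 1 / (2 * \<mu>) * (norm (c - y))\<^sup>2 \<le> h w + 1 / (2 * \<mu>) * (norm (c - w))\<^sup>2"
      using y unfolding prox_iff by blast
    moreover have "(norm (c - w))\<^sup>2 = (norm (c - y))\<^sup>2 - 2 * l * ((c - y) \<bullet> d) + l\<^sup>2 * (norm d)\<^sup>2"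
      unfolding cw power2_norm_eq_inner
      by (simp add: inner_diff_left inner_diff_right inner_commute power2_eq_square algebra_simps)
    ultimately have "0 \<le> l * (h z - h y) +
        1 / (2 * \<mu>) * (- 2 * l * ((c - y) \<bullet> d) + l\<^sup>2 * (norm d)\<^sup>2)"
      by (simp add: algebra_simps add_divide_distrib diff_divide_distrib)
    also have "\<dots> = l * (h z - h y - ((c - y) \<bullet> d / \<mu> - l / (2 * \<mu>) * (norm d)\<^sup>2))"
      using \<mu> by (simp add: field_simps power2_eq_square)
    finally show ?thesis using l by (simp add: zero_le_mult_iff)
  qed
  have "((\<lambda>l. (c - y) \<bullet> d / \<mu> - l / (2 * \<mu>) * (norm d)\<^sup>2) \<longlongrightarrow>
         (c - y) \<bullet> d / \<mu> - 0 / (2 * \<mu>) * (norm d)\<^sup>2) (at_right 0)"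
    by (intro tendsto_intros) (use \<mu> in auto)
  moreover have "eventually (\<lambda>l. (c - y) \<bullet> d / \<mu> - l / (2 * \<mu>) * (norm d)\<^sup>2 \<le> h z - h y) (at_right 0)"
    using eventually_at_right_real[of 0 "1::real"] * by (auto elim!: eventually_mono)
  ultimately have "(c - y) \<bullet> d / \<mu> - 0 / (2 * \<mu>) * (norm d)\<^sup>2 \<le> h z - h y"
    by (intro tendsto_upperbound) auto
  then show "h y + (1 / \<mu>) *\<^sub>R (c - y) \<bullet> (z - y) \<le> h z" by (simp add: d_def)
qed

text \<open>The penalty term expanded about \<open>y\<close>. The linear term that appears is exactly the one that
  the subgradient inequality at a proximal point cancels.\<close>
lemma quadratic_recentre:
  fixes c y z :: "'a::real_inner"
  shows "1 / (2 * \<mu>) * (norm (c - z))\<^sup>2 =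
    1 / (2 * \<mu>) * (norm (c - y))\<^sup>2 - ((c - y) \<bullet> (z - y)) / \<mu> + 1 / (2 * \<mu>) * (norm (z - y))\<^sup>2"
proof -
  have cz: "c - z = (c - y) - (z - y)" by simp
  have "(norm (c - z))\<^sup>2 = (norm (c - y))\<^sup>2 - 2 * ((c - y) \<bullet> (z - y)) + (norm (z - y))\<^sup>2"
    unfolding cz power2_norm_eq_inner
    by (simp only: inner_diff_left[of "c - y" "z - y"] inner_diff_right[of _ "c - y" "z - y"])
       (simp add: inner_commute)
  then show ?thesis by (simp add: add_divide_distrib diff_divide_distrib)
qed

lemma prox_quadratic_growth:
  assumes h: "convex_on UNIV h" and \<mu>: "\<mu> > 0" and y: "y \<in> prox h \<mu> c"
  shows "h y + 1 / (2 * \<mu>) * (norm (c - y))\<^sup>2 + 1 / (2 * \<mu>) * (norm (z - y))\<^sup>2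
         \<le> h z + 1 / (2 * \<mu>) * (norm (c - z))\<^sup>2"
proof -
  have "1 / (2 * \<mu>) * (norm (c - z))\<^sup>2 =
      1 / (2 * \<mu>) * (norm (c - y))\<^sup>2 - ((c - y) \<bullet> (z - y)) / \<mu> + 1 / (2 * \<mu>) * (norm (z - y))\<^sup>2"
    by (rule quadratic_recentre)
  moreover have "h y + ((c - y) \<bullet> (z - y)) / \<mu> \<le> h z"
    using prox_subgradient[OF assms] by (simp add: subdifferential_iff)
  ultimately show ?thesis by linarith
qed

text \<open>This is how the bound on the subgradients of \<open>h\<close> controls the constraint violation
  \<open>c - y\<close>: it vanishes linearly with the penalty parameter.\<close>
lemma prox_residual_bound:
  assumes h: "convex_on UNIV h" and L: "\<forall>z. \<forall>v\<in>subdifferential h z. norm v \<le> L"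
    and \<mu>: "\<mu> > 0" and y: "y \<in> prox h \<mu> c"
  shows "norm (c - y) \<le> \<mu> * L"
proof -
  have "norm ((1 / \<mu>) *\<^sub>R (c - y)) \<le> L"
    using L prox_subgradient[OF h \<mu> y] by blast
  then have "norm (c - y) / \<mu> \<le> L" using \<mu> by (simp only: norm_scaleR) simp
  then show ?thesis using \<mu> by (simp add: field_simps)
qed

text \<open>Lowering the parameter from \<open>\<mu>'\<close> to \<open>\<mu>\<close> turns the subgradient \<open>(c - y) / \<mu>'\<close> of \<open>h\<close> at the old
  proximal point \<open>y\<close> into \<open>(c - y) / \<mu>\<close>, so \<open>y\<close> fails the new optimality condition only by a vector of
  norm at most \<open>(\<mu>' - \<mu>) * L / \<mu>\<close>. The new objective \<open>q\<close> therefore satisfies a lower bound that is quadratic in the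
  distance to \<open>y\<close> with this small linear term. That makes \<open>q\<close> coercive, so a new proximal point exists,
  and, played against the quadratic growth of \<open>q\<close> at the new point, it yields the distance bound.\<close>
lemma prox_parameter_lipschitz:
  fixes h :: "real^'m \<Rightarrow> real"
  assumes h: "convex_on UNIV h" and L: "\<forall>z. \<forall>v\<in>subdifferential h z. norm v \<le> L"
    and \<mu>: "0 < \<mu>" "\<mu> \<le> \<mu>'" and y: "y \<in> prox h \<mu>' c"
  shows "\<exists>p\<in>prox h \<mu> c. dist y p \<le> (\<mu>' - \<mu>) * L"
proof -
  define q where "q z = h z + 1 / (2 * \<mu>) * (norm (c - z))\<^sup>2" for z
  have \<mu>': "\<mu>' > 0" using \<mu> by simp
  have res: "norm (c - y) \<le> \<mu>' * L" by (rule prox_residual_bound[OF h L \<mu>' y])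
  have L0: "L \<ge> 0" using res \<mu>' norm_ge_zero[of "c - y"] by (meson order_trans zero_le_mult_iff not_le)
  have grow: "q y - (\<mu>' - \<mu>) * L / \<mu> * norm (z - y) + (norm (z - y))\<^sup>2 / (2 * \<mu>) \<le> q z" for z
  proof -
    have "1 / (2 * \<mu>) * (norm (c - z))\<^sup>2 =
        1 / (2 * \<mu>) * (norm (c - y))\<^sup>2 - ((c - y) \<bullet> (z - y)) / \<mu> + 1 / (2 * \<mu>) * (norm (z - y))\<^sup>2"
      by (rule quadratic_recentre)
    moreover have "h y + ((c - y) \<bullet> (z - y)) / \<mu>' \<le> h z"
      using prox_subgradient[OF h \<mu>' y] by (simp add: subdifferential_iff)
    ultimately have "q y + (1 / \<mu>' - 1 / \<mu>) * ((c - y) \<bullet> (z - y)) + (norm (z - y))\<^sup>2 / (2 * \<mu>) \<le> q z"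
      by (simp add: q_def left_diff_distrib)
    moreover have "(1 / \<mu> - 1 / \<mu>') * ((c - y) \<bullet> (z - y)) \<le> (\<mu>' - \<mu>) * L / \<mu> * norm (z - y)"
    proof -
      have "(c - y) \<bullet> (z - y) \<le> norm (c - y) * norm (z - y)" by (rule norm_cauchy_schwarz)
      also have "\<dots> \<le> \<mu>' * L * norm (z - y)" by (intro mult_right_mono res) auto
      finally have "(1 / \<mu> - 1 / \<mu>') * ((c - y) \<bullet> (z - y)) \<le> (1 / \<mu> - 1 / \<mu>') * (\<mu>' * L * norm (z - y))"
        using \<mu> by (intro mult_left_mono) (auto simp: field_simps)
      also have "\<dots> = (\<mu>' - \<mu>) * L / \<mu> * norm (z - y)" using \<mu> \<mu>' by (simp add: field_simps)
      finally show ?thesis .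
    qed
    ultimately show ?thesis by (simp add: left_diff_distrib)
  qed
  \<comment> \<open>the radius beyond which the quadratic term of the lower bound dominates its linear term\<close>
  define r where "r = 2 * (\<mu>' - \<mu>) * L"
  have r: "r \<ge> 0" using \<mu> L0 by (simp add: r_def)
  have cont: "continuous_on UNIV q"
    unfolding q_def by (intro continuous_intros convex_on_continuous h) auto
  obtain p where p: "p \<in> cball y r" and pmin: "\<And>z. z \<in> cball y r \<Longrightarrow> q p \<le> q z"
    using continuous_attains_inf[OF compact_cball, of y r q] r continuous_on_subset[OF cont]
    by (metis cball_eq_empty not_le subset_UNIV)
  have glob: "q p \<le> q z" for z
  proof (cases "z \<in> cball y r")
    case False
    then have "norm (z - y) > r" by (simp add: dist_norm norm_minus_commute)
    then have "0 \<le> norm (z - y) * (norm (z - y) - r) / (2 * \<mu>)" using \<mu> by simp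
    also have "\<dots> = - ((\<mu>' - \<mu>) * L / \<mu> * norm (z - y)) + (norm (z - y))\<^sup>2 / (2 * \<mu>)"
      using \<mu> by (simp add: r_def field_simps power2_eq_square)
    finally have "q y \<le> q z" using grow[of z] by linarith
    then show ?thesis using pmin[of y] r by simp
  qed (use pmin in auto)
  have pp: "p \<in> prox h \<mu> c" using glob by (simp add: prox_iff q_def)
  have "q p + (norm (y - p))\<^sup>2 / (2 * \<mu>) \<le> q y"
    using prox_quadratic_growth[OF h \<mu>(1) pp, of y] by (simp add: q_def)
  with grow[of p] have "(norm (y - p))\<^sup>2 / \<mu> \<le> (\<mu>' - \<mu>) * L / \<mu> * norm (y - p)"
    by (simp add: norm_minus_commute)
  then have "norm (y - p) * norm (y - p) \<le> ((\<mu>' - \<mu>) * L) * norm (y - p)"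
    using \<mu> by (simp add: field_simps power2_eq_square)
  then have "norm (y - p) \<le> (\<mu>' - \<mu>) * L"
    using \<mu> L0 by (cases "norm (y - p) = 0") (auto simp: mult_le_cancel_right)
  then show ?thesis using pp by (auto simp: dist_norm)
qed

section \<open>The majorizer and the descent of one iteration\<close>

lemma gradient_eqI:
  assumes "GDERIV g x :> D"
  shows "gradient g x = D"
  unfolding gradient_def
proof (rule the_equality)
  fix D' assume "GDERIV g x :> D'"
  then have "(\<lambda>v. v \<bullet> D') = (\<lambda>v. v \<bullet> D)"
    using assms unfolding gderiv_def by (intro has_derivative_unique)
  then have "\<forall>v. v \<bullet> D' = v \<bullet> D" by (simp add: fun_eq_iff)
  then show "D' = D" by (simp only: vector_eq_rdot vector_eq_ldot)
qed (rule assms)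

lemma smooth_fun_GDERIV:
  assumes "smooth_fun g"
  shows "GDERIV g x :> gradient g x"
  using assms gradient_eqI unfolding smooth_fun_def by metis

lemma inner_vector_matrix_mult:
  fixes A :: "real^'n^'m"
  shows "v \<bullet> (r v* A) = (A *v v) \<bullet> r"
  by (metis dot_lmul_matrix inner_commute)

lemma gradient_Rfun:
  fixes A :: "real^'n^'m"
  assumes "GDERIV f x :> g"
  shows "gradient (\<lambda>u. Rfun f A b u y \<mu>) x = g + (1 / \<mu>) *\<^sub>R (transpose A *v (A *v x - b - y))"
proof (rule gradient_eqI, unfold gderiv_def Rfun_def)
  have A: "((\<lambda>u. A *v u) has_derivative (\<lambda>v. A *v v)) (at x)"
    by (rule bounded_linear.has_derivative[OF matrix_vector_mul_bounded_linear]) (rule has_derivative_ident)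
  have f: "(f has_derivative (\<lambda>v. v \<bullet> g)) (at x)" using assms by (simp add: gderiv_def)
  show "((\<lambda>u. f u + 1 / (2 * \<mu>) * (norm (A *v u - b - y))\<^sup>2) has_derivative
         (\<lambda>v. v \<bullet> (g + (1 / \<mu>) *\<^sub>R (transpose A *v (A *v x - b - y))))) (at x)"
    unfolding power2_norm_eq_inner
    by ((rule derivative_eq_intros A f refl)+,
        auto simp: inner_add_right inner_vector_matrix_mult fun_eq_iff, simp add: inner_commute)
qed

lemma norm_Q_square: "0 \<le> v \<bullet> (Q *v v) \<Longrightarrow> (norm_Q Q v)\<^sup>2 = v \<bullet> (Q *v v)"
  by (simp add: norm_Q_def)

lemma loewner_ge_scaled_identity:
  assumes "loewner_le (V *\<^sub>R mat 1) Q"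
  shows "V * (norm v)\<^sup>2 \<le> v \<bullet> (Q *v v)"
proof -
  have "0 \<le> v \<bullet> ((Q - V *\<^sub>R mat 1) *v v)"
    using assms unfolding loewner_le_def psd_def by blast
  also have "(Q - V *\<^sub>R mat 1) *v v = Q *v v - V *\<^sub>R v"
    by (simp add: matrix_vector_mult_diff_rdistrib scaleR_matrix_vector_assoc[symmetric])
  finally show ?thesis by (simp add: inner_diff_right power2_norm_eq_inner)
qed

text \<open>The penalty term is quadratic in \<open>x\<close>, and \<open>transpose A ** A / \<mu>\<close> is its Hessian, so the majorizer
  reproduces it exactly: linearization and proximal terms concern only \<open>f\<close>.\<close>
lemma major_eq:
  fixes A :: "real^'n^'m"
  assumes f: "smooth_fun f" and Mt: "\<And>v. 0 \<le> v \<bullet> (Mt *v v)"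
    and pos: "\<mu> > 0" "\<theta>1 > 0" "\<theta>2 > 0"
  shows "major f A b Mt \<theta>1 \<theta>2 x x' y \<mu> =
    f x' + (x - x') \<bullet> gradient f x' + 1 / 2 * (norm_Q Mt (x - x'))\<^sup>2
    + 1 / (2 * \<mu>) * (norm (A *v x - b - y))\<^sup>2 + (\<theta>1 / \<mu> + \<theta>2) / 2 * (norm (x - x'))\<^sup>2"
proof -
  define d where "d = x - x'"
  define r where "r = A *v x' - b - y"
  let ?Q = "(1 / \<mu>) *\<^sub>R (transpose A ** A + \<theta>1 *\<^sub>R mat 1) + Mt + \<theta>2 *\<^sub>R mat 1"
  have Q: "d \<bullet> (?Q *v d) = 1 / \<mu> * (norm (A *v d))\<^sup>2 + (\<theta>1 / \<mu> + \<theta>2) * (norm d)\<^sup>2 + d \<bullet> (Mt *v d)"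
    by (simp add: matrix_vector_mult_add_rdistrib scaleR_matrix_vector_assoc[symmetric]
        matrix_vector_mul_assoc[symmetric] inner_add_right inner_vector_matrix_mult power2_norm_eq_inner
        algebra_simps)
  have "0 \<le> d \<bullet> (?Q *v d)" unfolding Q using pos Mt by (intro add_nonneg_nonneg mult_nonneg_nonneg) auto
  then have nQ: "(norm_Q ?Q d)\<^sup>2 = 1 / \<mu> * (norm (A *v d))\<^sup>2 + (\<theta>1 / \<mu> + \<theta>2) * (norm d)\<^sup>2 + (norm_Q Mt d)\<^sup>2"
    by (simp add: norm_Q_square Mt Q)
  have "A *v x - b - y = r + A *v d" by (simp add: d_def r_def matrix_vector_mult_diff_distrib)
  then have sq: "(norm (A *v x - b - y))\<^sup>2 = (norm r)\<^sup>2 + 2 * ((A *v d) \<bullet> r) + (norm (A *v d))\<^sup>2"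
    by (simp add: power2_norm_eq_inner inner_add_left inner_add_right inner_commute)
  have "major f A b Mt \<theta>1 \<theta>2 x x' y \<mu> = f x' + 1 / (2 * \<mu>) * (norm r)\<^sup>2
      + (d \<bullet> gradient f x' + (1 / \<mu>) * ((A *v d) \<bullet> r)) + 1 / 2 * (norm_Q ?Q d)\<^sup>2"
    unfolding major_def gradient_Rfun[OF smooth_fun_GDERIV[OF f]] d_def[symmetric] r_def[symmetric]
    by (simp add: Rfun_def r_def inner_add_right inner_vector_matrix_mult)
  then show ?thesis
    unfolding nQ sq d_def[symmetric] by (simp add: algebra_simps add_divide_distrib)
qed

lemma merit_eq:
  "nnz x \<le> s \<Longrightarrow> Jfun f h A b s x y \<mu> = ereal (Rfun f A b x y \<mu> + h y)"
  by (simp add: Jfun_def sparse_ind_def)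

text \<open>Since the old iterate is feasible for the block subproblem, the majorizer at the new iterate is at
  most its value at the old one, where it coincides with \<open>Rfun\<close>; at the new iterate it exceeds
  \<open>Rfun\<close> by at least the proximal terms. The gain in \<open>y\<close> is the quadratic growth at a proximal point.\<close>
lemma descent_step:
  fixes A :: "real^'n^'m"
  assumes f: "smooth_fun f" and h: "convex_on UNIV h" and Mt: "\<And>v. 0 \<le> v \<bullet> (Mt *v v)"
    and f_Mt: "\<And>u u'. nnz u \<le> s \<Longrightarrow> nnz u' \<le> s \<Longrightarrow>
           f u' - f u - (u' - u) \<bullet> gradient f u \<le> 1 / 2 * (norm_Q Mt (u - u'))\<^sup>2"
    and pos: "\<mu> > 0" "\<theta>1 > 0" "\<theta>2 > 0"
    and x: "nnz x \<le> s"
    and x': "x' \<in> argmins (\<lambda>z. major f A b Mt \<theta>1 \<theta>2 z x y \<mu>)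
                              {z. nnz z \<le> s \<and> (\<forall>i. i \<notin> B \<longrightarrow> z $ i = x $ i)}"
    and y': "y' \<in> prox h \<mu> (A *v x' - b)"
  shows "Rfun f A b x' y' \<mu> + h y' + (\<theta>1 / \<mu> + \<theta>2) / 2 * (norm (x' - x))\<^sup>2
           + 1 / (2 * \<mu>) * (norm (y' - y))\<^sup>2 \<le> Rfun f A b x y \<mu> + h y"
proof -
  have s': "nnz x' \<le> s"
    and le: "major f A b Mt \<theta>1 \<theta>2 x' x y \<mu> \<le> major f A b Mt \<theta>1 \<theta>2 x x y \<mu>"
    using x' x by (auto simp: argmins_def is_arg_min_linorder)
  have nQ: "norm_Q Mt (x - x') = norm_Q Mt (x' - x)"
    using matrix_vector_mult_diff_distrib[of Mt] by (simp add: norm_Q_def inner_diff_left inner_diff_right)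
  have "norm_Q Mt 0 = 0" by (simp add: norm_Q_def)
  then have "Rfun f A b x' y \<mu> + (\<theta>1 / \<mu> + \<theta>2) / 2 * (norm (x' - x))\<^sup>2 \<le> Rfun f A b x y \<mu>"
    using le f_Mt[OF x s'] unfolding major_eq[OF f Mt pos] by (simp add: Rfun_def nQ)
  moreover have "h y' + 1 / (2 * \<mu>) * (norm (A *v x' - b - y'))\<^sup>2 + 1 / (2 * \<mu>) * (norm (y - y'))\<^sup>2
      \<le> h y + 1 / (2 * \<mu>) * (norm (A *v x' - b - y))\<^sup>2"
    by (rule prox_quadratic_growth[OF h pos(1) y'])
  ultimately show ?thesis by (simp add: Rfun_def norm_minus_commute[of y y'])
qed

text \<open>The parameter enters through the weight of the squared residual only, and at the proximal point
  \<open>y\<close> for the old parameter the residual has norm at most \<open>\<mu>' * L\<close>.\<close>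
lemma merit_penalty_change:
  fixes A :: "real^'n^'m"
  assumes h: "convex_on UNIV h" and L: "\<forall>z. \<forall>v\<in>subdifferential h z. norm v \<le> L"
    and \<mu>: "0 < \<mu>" "\<mu> \<le> \<mu>'" and y: "y \<in> prox h \<mu>' (A *v x - b)"
  shows "Rfun f A b x y \<mu> \<le> Rfun f A b x y \<mu>' + L\<^sup>2 / 2 * (\<mu>'\<^sup>2 / \<mu> - \<mu>')"
proof -
  have \<mu>': "\<mu>' > 0" using \<mu> by simp
  have "(norm (A *v x - b - y))\<^sup>2 \<le> (\<mu>' * L)\<^sup>2"
    by (intro power_mono prox_residual_bound[OF h L \<mu>' y]) auto
  then have "(1 / (2 * \<mu>) - 1 / (2 * \<mu>')) * (norm (A *v x - b - y))\<^sup>2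
      \<le> (1 / (2 * \<mu>) - 1 / (2 * \<mu>')) * (\<mu>' * L)\<^sup>2"
    using \<mu> by (intro mult_left_mono) (auto simp: field_simps)
  also have "\<dots> = L\<^sup>2 / 2 * (\<mu>'\<^sup>2 / \<mu> - \<mu>')"
    using \<mu> \<mu>' by (simp add: field_simps power2_eq_square)
  finally show ?thesis unfolding Rfun_def left_diff_distrib by linarith
qed

text \<open>Replace \<open>h\<close> by an affine minorant with slope \<open>v\<close>, touching at \<open>y0\<close>. The penalty term dominates the
  variation of this minorant in the residual, up to an error of \<open>\<mu> * (norm v)\<^sup>2 / 2\<close>, and what remains
  is linear in \<open>x\<close> and dominated by the strong convexity of \<open>f\<close>. Both times this is Young's
  inequality \<open>young\<close>.\<close>
lemma merit_bounded_below:
  fixes A :: "real^'n^'m"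
  assumes V: "V > 0"
    and sc: "\<And>u. nnz u \<le> s \<Longrightarrow> f 0 + u \<bullet> g + V / 2 * (norm u)\<^sup>2 \<le> f u"
    and v: "v \<in> subdifferential h y0"
  shows "\<exists>c. \<forall>x y \<mu>. nnz x \<le> s \<longrightarrow> 0 < \<mu> \<longrightarrow> \<mu> \<le> \<mu>max \<longrightarrow> c \<le> Rfun f A b x y \<mu> + h y"
proof (intro exI allI impI)
  fix x :: "real^'n" and y :: "real^'m" and \<mu> :: real
  assume x: "nnz x \<le> s" and \<mu>: "0 < \<mu>" "\<mu> \<le> \<mu>max"
  let ?w = "g + transpose A *v v"
  have young: "- (norm p)\<^sup>2 / (2 * a) \<le> p \<bullet> q + a / 2 * (norm q)\<^sup>2" if "a > 0"
    for a :: real and p q :: "'z::real_inner"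
  proof -
    have "0 \<le> (norm ((1 / a) *\<^sub>R p + q))\<^sup>2 * (a / 2)" using that by simp
    also have "\<dots> = (norm p)\<^sup>2 / (2 * a) + p \<bullet> q + a / 2 * (norm q)\<^sup>2"
      unfolding power2_norm_eq_inner using that
      by (simp add: inner_add_left inner_add_right inner_commute field_simps)
    finally show ?thesis by simp
  qed
  define r where "r = A *v x - b - y"
  have adj: "x \<bullet> (transpose A *v v) = (A *v x) \<bullet> v"
    by (simp add: inner_vector_matrix_mult)
  have "- (norm v)\<^sup>2 / (2 * (1 / \<mu>)) \<le> (- v) \<bullet> r + 1 / \<mu> / 2 * (norm r)\<^sup>2"
    using young[of "1 / \<mu>" "- v" r] \<mu> by simp
  moreover have "- (norm v)\<^sup>2 / (2 * (1 / \<mu>)) \<ge> - \<mu>max * (norm v)\<^sup>2 / 2"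
    using mult_right_mono[OF \<mu>(2), of "(norm v)\<^sup>2"] \<mu> by (simp add: field_simps)
  moreover have "h y0 + v \<bullet> (y - y0) \<le> h y" using v by (simp add: subdifferential_iff)
  moreover have "f 0 + x \<bullet> g + V / 2 * (norm x)\<^sup>2 \<le> f x" by (rule sc[OF x])
  moreover have "- (norm ?w)\<^sup>2 / (2 * V) \<le> ?w \<bullet> x + V / 2 * (norm x)\<^sup>2" by (rule young[OF V])
  moreover have "?w \<bullet> x = x \<bullet> g + v \<bullet> (A *v x)"
    unfolding inner_add_left using adj inner_commute[of g x] inner_commute[of "transpose A *v v" x]
      inner_commute[of v "A *v x"] by linarith
  moreover have "v \<bullet> (y - y0) = v \<bullet> (A *v x) - v \<bullet> r - v \<bullet> b - v \<bullet> y0"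
    by (simp add: r_def inner_diff_right)
  moreover have "Rfun f A b x y \<mu> = f x + 1 / \<mu> / 2 * (norm r)\<^sup>2" by (simp add: Rfun_def r_def)
  ultimately show "f 0 + h y0 - v \<bullet> b - v \<bullet> y0 - (norm ?w)\<^sup>2 / (2 * V) - \<mu>max * (norm v)\<^sup>2 / 2
      \<le> Rfun f A b x y \<mu> + h y"
    by (simp add: inner_minus_left)
qed

section \<open>The stationarity measure\<close>

text \<open>The working set is an argument of its own, so that the gap can also be taken at the set drawn at
  random.\<close>
definition block_gap :: "(real^'n \<Rightarrow> real) \<Rightarrow> real^'n^'m \<Rightarrow> real^'m \<Rightarrow> nat
    \<Rightarrow> real^'n^'n \<Rightarrow> real \<Rightarrow> real \<Rightarrow> 'n set \<Rightarrow> real^'n \<Rightarrow> real^'m \<Rightarrow> real \<Rightarrow> ennreal" where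
  "block_gap f A b s Mt \<theta>1 \<theta>2 B x y \<mu> =
     dist2 (block B x)
       (argmins (\<lambda>z. sparse_ind s (z + block (- B) x)
                     + ereal (major f A b Mt \<theta>1 \<theta>2 (z + block (- B) x) x y \<mu>))
                (block_space B))"

lemma dist2_le: "w \<in> S \<Longrightarrow> dist2 z S \<le> ennreal ((dist z w)\<^sup>2)"
  unfolding dist2_def by (rule INF_lower)

lemma prox_minimizes_merit:
  assumes "nnz x \<le> s" "p \<in> prox h \<mu> (A *v x - b)"
  shows "p \<in> argmins (\<lambda>y'. Jfun f h A b s x y' \<mu>) UNIV"
  using assms by (auto simp: argmins_def is_arg_min_linorder merit_eq prox_iff Rfun_def
      algebra_simps)

text \<open>Feasible points of the block subproblem agree with \<open>x\<close> off \<open>B\<close>, so they correspond to the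
  vectors \<open>z\<close> of \<open>block_space B\<close>, and the solution \<open>x'\<close> corresponds to \<open>block B x'\<close>. As \<open>x'\<close> and \<open>x\<close>
  differ only in \<open>B\<close>, the distance of their blocks is the distance of the vectors.\<close>
lemma block_gap_le_step:
  assumes x': "x' \<in> argmins (\<lambda>z. major f A b Mt \<theta>1 \<theta>2 z x y \<mu>)
                 {z. nnz z \<le> s \<and> (\<forall>i. i \<notin> B \<longrightarrow> z $ i = x $ i)}"
  shows "block_gap f A b s Mt \<theta>1 \<theta>2 B x y \<mu> \<le> ennreal ((norm (x' - x))\<^sup>2)"
proof -
  have s': "nnz x' \<le> s" and off: "\<And>i. i \<notin> B \<Longrightarrow> x' $ i = x $ i"
    and min: "\<And>z. nnz z \<le> s \<Longrightarrow> (\<And>i. i \<notin> B \<Longrightarrow> z $ i = x $ i) \<Longrightarrow>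
        major f A b Mt \<theta>1 \<theta>2 x' x y \<mu> \<le> major f A b Mt \<theta>1 \<theta>2 z x y \<mu>"
    using x' by (auto simp: argmins_def is_arg_min_linorder)
  have x'_eq: "block B x' + block (- B) x = x'"
    using off by (simp add: vec_eq_iff block_def)
  have "block B x' \<in> argmins (\<lambda>z. sparse_ind s (z + block (- B) x)
            + ereal (major f A b Mt \<theta>1 \<theta>2 (z + block (- B) x) x y \<mu>)) (block_space B)"
    unfolding argmins_def mem_Collect_eq is_arg_min_linorder x'_eq
  proof (intro conjI ballI allI impI)
    show "block B x' \<in> block_space B" by (simp add: block_def block_space_def)
    fix z assume "z \<in> block_space B"
    then have "(z + block (- B) x) $ i = x $ i" if "i \<notin> B" for i
      using that by (simp add: block_space_def block_def)
    then show "sparse_ind s x' + ereal (major f A b Mt \<theta>1 \<theta>2 x' x y \<mu>)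
        \<le> sparse_ind s (z + block (- B) x)
          + ereal (major f A b Mt \<theta>1 \<theta>2 (z + block (- B) x) x y \<mu>)"
      using s' min by (auto simp: sparse_ind_def)
  qed
  then have "block_gap f A b s Mt \<theta>1 \<theta>2 B x y \<mu> \<le> ennreal ((dist (block B x) (block B x'))\<^sup>2)"
    unfolding block_gap_def by (rule dist2_le)
  also have "block B x - block B x' = x - x'"
    using off by (simp add: vec_eq_iff block_def)
  then have "dist (block B x) (block B x') = norm (x' - x)" by (simp add: dist_norm norm_minus_commute)
  finally show ?thesis .
qed

lemma stationarity_le:
  fixes A :: "real^'n^'m"
  assumes h: "convex_on UNIV h" and L: "\<forall>z. \<forall>v\<in>subdifferential h z. norm v \<le> L"
    and \<mu>: "0 < \<mu>" "\<mu> \<le> \<mu>'" and x: "nnz x \<le> s" and y: "y \<in> prox h \<mu>' (A *v x - b)"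
  shows "stationarity f h A b s Mt \<theta>1 \<theta>2 k x y \<mu> \<le> ennreal ((L * (\<mu>' - \<mu>))\<^sup>2) +
    1 / of_nat (card (working_sets k :: 'n set set)) *
      (\<Sum>B\<in>working_sets k. block_gap f A b s Mt \<theta>1 \<theta>2 B x y \<mu>)"
proof -
  obtain p where p: "p \<in> prox h \<mu> (A *v x - b)" "dist y p \<le> (\<mu>' - \<mu>) * L"
    using prox_parameter_lipschitz[OF h L \<mu> y] by blast
  have "dist2 y (argmins (\<lambda>y'. Jfun f h A b s x y' \<mu>) UNIV) \<le> ennreal ((dist y p)\<^sup>2)"
    by (intro dist2_le prox_minimizes_merit x p)
  also have "\<dots> \<le> ennreal ((L * (\<mu>' - \<mu>))\<^sup>2)"
    using p(2) by (intro ennreal_leI power_mono) (auto simp: mult.commute)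
  finally show ?thesis
    using n_subsets[of "UNIV :: 'n set" k]
    by (auto simp: stationarity_def block_gap_def working_sets_def intro!: add_mono)
qed

section \<open>The two schedules of the penalty parameter\<close>

lemma penalty_pos:
  assumes "(\<exists>\<mu>bar>0. \<forall>t. \<mu> t = \<mu>bar) \<or> (\<exists>t0\<ge>1. \<forall>t. \<mu> t = \<eta> / (real t + t0))" "\<eta> > 0"
  shows "\<mu> t > 0"
  using assms by (auto intro!: divide_pos_pos add_nonneg_pos)

lemma penalty_antimono:
  assumes "(\<exists>\<mu>bar>0. \<forall>t. \<mu> t = \<mu>bar) \<or> (\<exists>t0\<ge>1. \<forall>t. \<mu> t = \<eta> / (real t + t0))" "\<eta> > 0"
    and "t \<le> t'"
  shows "\<mu> t' \<le> \<mu> t"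
  using assms by (auto intro!: divide_left_mono mult_pos_pos add_nonneg_pos)

text \<open>For \<open>\<mu> t = \<eta> / (t + t0)\<close> write \<open>j = t - 1 + t0\<close>. In units of \<open>\<eta> * L\<^sup>2 / 2\<close>, the first term of the sum
  is \<open>1 / j\<^sup>2\<close>, and the second one is at most \<open>1 / (j * (j + 1)\<^sup>2)\<close> since \<open>m \<le> t0 / \<eta> \<le> j / \<eta>\<close>.
  Their sum telescopes with \<open>g j = 1 / j + 1 / j\<^sup>2\<close>, and \<open>g t0 \<le> 2\<close> because \<open>t0 \<ge> 1\<close>. For \<open>t0 = 1\<close> the
  bound tends to \<open>g 1 = 2\<close> as \<open>T\<close> grows and leaves no slack. For a constant parameter all terms vanish.\<close>
lemma penalty_budget:
  assumes \<mu>: "(\<exists>\<mu>bar>0. \<forall>t. \<mu> t = \<mu>bar) \<or> (\<exists>t0\<ge>1. \<forall>t. \<mu> t = \<eta> / (real t + t0))"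
    and \<eta>: "\<eta> > 0" and m: "0 \<le> m" "m \<le> 1 / \<mu> 0"
  shows "(\<Sum>t=1..T. Psi L \<mu> t + m / 2 * (L * (\<mu> (t - 1) - \<mu> t))\<^sup>2) \<le> \<eta> * L\<^sup>2"
  using \<mu>
proof
  assume "\<exists>\<mu>bar>0. \<forall>t. \<mu> t = \<mu>bar"
  then show ?thesis using \<eta> by (auto simp: Psi_def power2_eq_square)
next
  assume "\<exists>t0\<ge>1. \<forall>t. \<mu> t = \<eta> / (real t + t0)"
  then obtain t0 where t0: "t0 \<ge> 1" and \<mu>t: "\<And>t. \<mu> t = \<eta> / (real t + t0)" by blast
  define g where "g j = 1 / j + 1 / j\<^sup>2" for j :: real
  have step: "Psi L \<mu> t + m / 2 * (L * (\<mu> (t - 1) - \<mu> t))\<^sup>2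
      \<le> \<eta> * L\<^sup>2 / 2 * (g (real t - 1 + t0) - g (real t + t0))" if t: "t \<ge> 1" for t
  proof -
    define j where "j = real t - 1 + t0"
    have j: "j \<ge> t0" "j \<ge> 1" "j > 0" "j \<noteq> 0" "j + 1 \<noteq> 0" using t t0 by (auto simp: j_def)
    have \<mu>j: "\<mu> (t - 1) = \<eta> / j" "\<mu> t = \<eta> / (j + 1)"
      using t by (simp_all add: \<mu>t j_def of_nat_diff algebra_simps)
    have "Psi L \<mu> t = \<eta> * L\<^sup>2 / 2 * (1 / j\<^sup>2)"
      using \<eta> j unfolding Psi_def \<mu>j by (simp add: field_simps power2_eq_square)
    moreover have "m / 2 * (L * (\<mu> (t - 1) - \<mu> t))\<^sup>2 \<le> \<eta> * L\<^sup>2 / 2 * (1 / (j * (j + 1)\<^sup>2))"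
    proof -
      have diff: "\<mu> (t - 1) - \<mu> t = \<eta> / (j * (j + 1))" unfolding \<mu>j using j by (simp add: field_simps)
      have "m \<le> j / \<eta>" using m(2) j \<eta> by (simp add: \<mu>t divide_right_mono order_trans)
      then have "m / 2 * (L * (\<mu> (t - 1) - \<mu> t))\<^sup>2 \<le> j / \<eta> / 2 * (L * (\<mu> (t - 1) - \<mu> t))\<^sup>2"
        by (intro mult_right_mono divide_right_mono) auto
      also have "\<dots> = \<eta> * L\<^sup>2 / 2 * (1 / (j * (j + 1)\<^sup>2))"
      proof -
        have "j / \<eta> / 2 * (L * (\<eta> / (j * c)))\<^sup>2 = \<eta> * L\<^sup>2 / 2 * (1 / (j * c\<^sup>2))" if "c \<noteq> 0" for c
          using \<eta> j(4) that by (simp add: field_simps power2_eq_square)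
        then show ?thesis unfolding diff using j(5) by blast
      qed
      finally show ?thesis .
    qed
    moreover have "1 / j\<^sup>2 + 1 / (j * (j + 1)\<^sup>2) = g j - g (j + 1)"
      using j(4,5) unfolding g_def by (simp add: divide_simps power2_eq_square) algebra
    ultimately have "Psi L \<mu> t + m / 2 * (L * (\<mu> (t - 1) - \<mu> t))\<^sup>2
        \<le> \<eta> * L\<^sup>2 / 2 * (g j - g (j + 1))"
      by (metis add_mono distrib_left order_refl)
    then show ?thesis by (simp add: j_def add.commute)
  qed
  have "(\<Sum>t=1..T. Psi L \<mu> t + m / 2 * (L * (\<mu> (t - 1) - \<mu> t))\<^sup>2)
      \<le> (\<Sum>t=1..T. \<eta> * L\<^sup>2 / 2 * (g (real t - 1 + t0) - g (real t + t0)))"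
    by (intro sum_mono step) auto
  also have "\<dots> = \<eta> * L\<^sup>2 / 2 * (g t0 - g (real T + t0))"
    by (induction T) (simp_all add: algebra_simps)
  also have "\<dots> \<le> \<eta> * L\<^sup>2 / 2 * 2"
  proof (intro mult_left_mono)
    have "1 / t0 \<le> 1" "1 / t0\<^sup>2 \<le> 1" using t0 by (auto simp: divide_le_eq_1)
    then show "g t0 - g (real T + t0) \<le> 2"
      using t0 unfolding g_def by (smt (verit) of_nat_0_le_iff zero_le_divide_1_iff zero_le_power2)
  qed (use \<eta> in auto)
  finally show ?thesis by simp
qed

section \<open>Random variables determined by the past draws\<close>

text \<open>The sets drawn before step \<open>t\<close>, as a list: lists over a finite type form a countable type, so that
  every function of the history is measurable.\<close>
definition history :: "(nat \<Rightarrow> 'w \<Rightarrow> 'b) \<Rightarrow> nat \<Rightarrow> 'w \<Rightarrow> 'b list" where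
  "history B t \<omega> = map (\<lambda>i. B i \<omega>) [1..<t]"

text \<open>Turns the pointwise description of a random variable that depends on the past draws only
  into a factorization through the history; the factor picks any outcome with the given history.\<close>
lemma determined_by_history:
  assumes "\<forall>\<omega>\<in>\<Omega>. \<forall>\<omega>'\<in>\<Omega>. (\<forall>i\<in>{1..<t}. B i \<omega> = B i \<omega>') \<longrightarrow> G \<omega> = G \<omega>'"
  shows "\<exists>g. \<forall>\<omega>\<in>\<Omega>. G \<omega> = g (history B t \<omega>)"
proof (intro exI ballI)
  fix \<omega> assume \<omega>: "\<omega> \<in> \<Omega>"
  let ?\<omega>' = "SOME \<omega>'. \<omega>' \<in> \<Omega> \<and> history B t \<omega>' = history B t \<omega>"
  have "?\<omega>' \<in> \<Omega> \<and> history B t ?\<omega>' = history B t \<omega>"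
    by (rule someI[of _ \<omega>]) (use \<omega> in simp)
  then have "?\<omega>' \<in> \<Omega>" "\<forall>i\<in>{1..<t}. B i \<omega> = B i ?\<omega>'"
    by (auto simp: history_def)
  then show "G \<omega> = (\<lambda>xs. G (SOME \<omega>'. \<omega>' \<in> \<Omega> \<and> history B t \<omega>' = xs)) (history B t \<omega>)"
    using assms \<omega> by blast
qed

lemma measurable_map_count_space:
  fixes F :: "'i \<Rightarrow> 'w \<Rightarrow> 'b::countable"
  assumes "\<And>i. i \<in> set is \<Longrightarrow> F i \<in> measurable N (count_space UNIV)"
  shows "(\<lambda>\<omega>. map (\<lambda>i. F i \<omega>) is) \<in> measurable N (count_space UNIV)"
  using assms
proof (induction "is")
  case (Cons i "is")
  have "(\<lambda>\<omega>. (F i \<omega>, map (\<lambda>i. F i \<omega>) is)) \<in> measurable N (count_space UNIV \<Otimes>\<^sub>M count_space UNIV)"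
    using Cons by (intro measurable_Pair) auto
  then have "(\<lambda>\<omega>. (F i \<omega>, map (\<lambda>i. F i \<omega>) is)) \<in> measurable N (count_space UNIV)"
    by (simp add: pair_measure_countable)
  from measurable_compose[OF this, of "\<lambda>(a, l). a # l" "count_space UNIV"]
  show ?case by simp
qed simp

lemma (in prob_space) measurable_history:
  fixes B :: "nat \<Rightarrow> 'a \<Rightarrow> 'b::countable"
  assumes B: "indep_vars (\<lambda>_. count_space UNIV) B {1..}"
  shows "history B t \<in> measurable M (count_space UNIV)"
  unfolding history_def using B
  by (intro measurable_map_count_space) (auto simp: indep_vars_def)

lemma (in prob_space) borel_measurable_function_of_history:
  fixes B :: "nat \<Rightarrow> 'a \<Rightarrow> 'b::countable" and \<phi> :: "'a \<Rightarrow> 'c::topological_space"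
  assumes B: "indep_vars (\<lambda>_. count_space UNIV) B {1..}"
    and \<phi>: "\<forall>\<omega>\<in>space M. \<forall>\<omega>'\<in>space M. (\<forall>i\<in>{1..<t}. B i \<omega> = B i \<omega>') \<longrightarrow> \<phi> \<omega> = \<phi> \<omega>'"
  shows "\<phi> \<in> borel_measurable M"
proof -
  obtain g where g: "\<And>\<omega>. \<omega> \<in> space M \<Longrightarrow> \<phi> \<omega> = g (history B t \<omega>)"
    using determined_by_history[OF \<phi>] by blast
  have "(\<lambda>\<omega>. g (history B t \<omega>)) \<in> borel_measurable M"
    using measurable_compose[OF measurable_history[OF B], of g borel] by simp
  then show ?thesis using g by (subst measurable_cong) auto
qed

text \<open>Only finitely many histories of a given length exist, so such a variable is bounded.\<close>
lemma (in prob_space) integrable_function_of_history: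
  fixes B :: "nat \<Rightarrow> 'a \<Rightarrow> 'b::finite" and \<phi> :: "'a \<Rightarrow> real"
  assumes B: "indep_vars (\<lambda>_. count_space UNIV) B {1..}"
    and \<phi>: "\<forall>\<omega>\<in>space M. \<forall>\<omega>'\<in>space M. (\<forall>i\<in>{1..<t}. B i \<omega> = B i \<omega>') \<longrightarrow> \<phi> \<omega> = \<phi> \<omega>'"
  shows "integrable M \<phi>"
proof -
  obtain g where g: "\<And>\<omega>. \<omega> \<in> space M \<Longrightarrow> \<phi> \<omega> = g (history B t \<omega>)"
    using determined_by_history[OF \<phi>] by blast
  have "finite {xs :: 'b list. length xs = t - 1}"
    using finite_lists_length_eq[of "UNIV :: 'b set"] by simp
  then have "AE \<omega> in M. norm (\<phi> \<omega>) \<le> Max ((\<lambda>xs. norm (g xs)) ` {xs. length xs = t - 1})"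
    by (intro AE_I2 Max_ge) (auto simp: g history_def)
  then show ?thesis
    by (rule integrable_const_bound) (rule borel_measurable_function_of_history[OF B \<phi>])
qed

text \<open>The present draw is presented as a singleton list because \<open>indep_var\<close> relates
  variables with values in the same type.\<close>
lemma (in prob_space) indep_var_history:
  fixes B :: "nat \<Rightarrow> 'a \<Rightarrow> 'b::countable"
  assumes B: "indep_vars (\<lambda>_. count_space UNIV) B {1..}" and t: "t \<ge> 1"
  shows "indep_var (count_space UNIV) (history B t) (count_space UNIV) (\<lambda>\<omega>. [B t \<omega>])"
proof -
  have read: "(\<lambda>F :: nat \<Rightarrow> 'b. map F is) \<in> measurable (PiM (set is) (\<lambda>_. count_space UNIV)) (count_space UNIV)" for "is"
    by (rule measurable_map_count_space[where F = "\<lambda>i F. F i"]) simp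
  have "indep_var (PiM {1..<t} (\<lambda>_. count_space UNIV)) (\<lambda>\<omega>. restrict (\<lambda>i. B i \<omega>) {1..<t})
      (PiM {t} (\<lambda>_. count_space UNIV)) (\<lambda>\<omega>. restrict (\<lambda>i. B i \<omega>) {t})"
    using t by (intro indep_var_restrict[OF B]) auto
  then have "indep_var (count_space UNIV) ((\<lambda>F. map F [1..<t]) \<circ> (\<lambda>\<omega>. restrict (\<lambda>i. B i \<omega>) {1..<t}))
      (count_space UNIV) ((\<lambda>F. map F [t]) \<circ> (\<lambda>\<omega>. restrict (\<lambda>i. B i \<omega>) {t}))"
    by (rule indep_var_compose) (use read[of "[1..<t]"] read[of "[t]"] in auto)
  also have "(\<lambda>F. map F [1..<t]) \<circ> (\<lambda>\<omega>. restrict (\<lambda>i. B i \<omega>) {1..<t}) = history B t"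
    by (auto simp: history_def fun_eq_iff)
  also have "(\<lambda>F. map F [t]) \<circ> (\<lambda>\<omega>. restrict (\<lambda>i. B i \<omega>) {t}) = (\<lambda>\<omega>. [B t \<omega>])"
    by (auto simp: fun_eq_iff)
  finally show ?thesis .
qed

text \<open>By independence the joint law of history and present draw is a product measure. Integrating
  over the draw first, with the history held fixed, turns the value at the drawn element into the
  average over \<open>W\<close>.\<close>
lemma (in prob_space) uniform_draw_average:
  fixes B :: "nat \<Rightarrow> 'a \<Rightarrow> 'b::finite" and D :: "'b \<Rightarrow> 'a \<Rightarrow> ennreal"
  assumes B: "indep_vars (\<lambda>_. count_space UNIV) B {1..}" and t: "t \<ge> 1"
    and W: "distr M (count_space UNIV) (B t) = measure_pmf (pmf_of_set W)" "W \<noteq> {}"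
    and D: "\<And>b. \<forall>\<omega>\<in>space M. \<forall>\<omega>'\<in>space M. (\<forall>i\<in>{1..<t}. B i \<omega> = B i \<omega>') \<longrightarrow> D b \<omega> = D b \<omega>'"
  shows "(\<integral>\<^sup>+\<omega>. 1 / of_nat (card W) * (\<Sum>b\<in>W. D b \<omega>) \<partial>M) = (\<integral>\<^sup>+\<omega>. D (B t \<omega>) \<omega> \<partial>M)"
proof -
  obtain g where g: "\<And>b \<omega>. \<omega> \<in> space M \<Longrightarrow> D b \<omega> = g b (history B t \<omega>)"
    using determined_by_history[OF D] by metis
  let ?C = "count_space UNIV :: 'b measure" and ?CL = "count_space UNIV :: 'b list measure"
  let ?X = "history B t" and ?Y = "\<lambda>\<omega>. [B t \<omega>]"
  let ?F = "\<lambda>(xs, l). g (hd l) xs"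
  have ind: "indep_var ?CL ?X ?CL ?Y" by (rule indep_var_history[OF B t])
  have X: "?X \<in> measurable M ?CL" and Y: "?Y \<in> measurable M ?CL"
    using indep_var_rv1[OF ind] indep_var_rv2[OF ind] by auto
  have Bt: "B t \<in> measurable M ?C" using B t by (auto simp: indep_vars_def)
  interpret Y: prob_space "distr M ?CL ?Y" by (rule prob_space_distr[OF Y])
  have F: "?F \<in> borel_measurable (?CL \<Otimes>\<^sub>M ?CL)"
    by (simp add: pair_measure_countable)
  then have F': "?F \<in> borel_measurable (distr M ?CL ?X \<Otimes>\<^sub>M distr M ?CL ?Y)"
    by (simp add: pair_measure_countable cong: measurable_cong_sets)
  have draw: "(\<integral>\<^sup>+l. g (hd l) xs \<partial>distr M ?CL ?Y) = 1 / of_nat (card W) * (\<Sum>b\<in>W. g b xs)" for xs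
  proof -
    have "(\<integral>\<^sup>+l. g (hd l) xs \<partial>distr M ?CL ?Y) = (\<integral>\<^sup>+\<omega>. g (B t \<omega>) xs \<partial>M)"
      by (subst nn_integral_distr[OF Y]) auto
    also have "\<dots> = (\<integral>\<^sup>+b. g b xs \<partial>distr M ?C (B t))"
      by (subst nn_integral_distr[OF Bt]) auto
    finally show ?thesis
      unfolding W(1) using W(2) by (simp add: nn_integral_pmf_of_set divide_ennreal_def mult.commute)
  qed
  have "(\<integral>\<^sup>+\<omega>. D (B t \<omega>) \<omega> \<partial>M) = (\<integral>\<^sup>+\<omega>. ?F (?X \<omega>, ?Y \<omega>) \<partial>M)"
    by (intro nn_integral_cong) (simp add: g)
  also have "\<dots> = (\<integral>\<^sup>+p. ?F p \<partial>distr M (?CL \<Otimes>\<^sub>M ?CL) (\<lambda>\<omega>. (?X \<omega>, ?Y \<omega>)))"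
    by (rule nn_integral_distr[symmetric]) (use F X Y in \<open>auto intro: measurable_Pair\<close>)
  also have "\<dots> = (\<integral>\<^sup>+p. ?F p \<partial>(distr M ?CL ?X \<Otimes>\<^sub>M distr M ?CL ?Y))"
    using ind unfolding indep_var_distribution_eq by simp
  also have "\<dots> = (\<integral>\<^sup>+xs. \<integral>\<^sup>+l. g (hd l) xs \<partial>distr M ?CL ?Y \<partial>distr M ?CL ?X)"
    using Y.nn_integral_fst[OF F'] by simp
  also have "\<dots> = (\<integral>\<^sup>+\<omega>. 1 / of_nat (card W) * (\<Sum>b\<in>W. g b (?X \<omega>)) \<partial>M)"
    unfolding draw by (rule nn_integral_distr[OF X]) simp
  also have "\<dots> = (\<integral>\<^sup>+\<omega>. 1 / of_nat (card W) * (\<Sum>b\<in>W. D b \<omega>) \<partial>M)"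
    by (intro nn_integral_cong) (simp add: g)
  finally show ?thesis by simp
qed

section \<open>Descent and iteration complexity\<close>

theorem theorem4p10:
  fixes A :: "real^'n^'m" and b :: "real^'m"
    and f :: "real^'n \<Rightarrow> real" and h :: "real^'m \<Rightarrow> real"
    and Mt :: "real^'n^'n" and x1 :: "real^'n"
    and s k :: nat
    and Lh Vs Ms As \<theta>1 \<theta>2 \<eta> \<theta> :: real
    and \<mu> :: "nat \<Rightarrow> real"
    and M :: "'w measure"
    and B :: "nat \<Rightarrow> 'w \<Rightarrow> 'n set"
    and x :: "nat \<Rightarrow> 'w \<Rightarrow> real^'n" and y :: "nat \<Rightarrow> 'w \<Rightarrow> real^'m"
  assumes s: "1 \<le> s" "s \<le> CARD('n)"
    and k: "2 \<le> k" "k \<le> CARD('n)"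
    and f: "smooth_fun f" "convex_on UNIV f"
    and h: "convex_on UNIV h"
    and h_subgrad: "\<forall>z. \<forall>v\<in>subdifferential h z. norm v \<le> Lh"
    and Vs_Ms: "Vs > 0" "Ms > 0"
    and f_bounds: "\<forall>u u'. nnz u \<le> s \<longrightarrow> nnz u' \<le> s \<longrightarrow>
           Vs / 2 * (norm (u - u'))\<^sup>2 \<le> f u' - f u - (u' - u) \<bullet> gradient f u \<and>
           f u' - f u - (u' - u) \<bullet> gradient f u \<le> Ms / 2 * (norm (u - u'))\<^sup>2"
    and Mt: "transpose Mt = Mt" "loewner_le (Vs *\<^sub>R mat 1) Mt" "loewner_le Mt (Ms *\<^sub>R mat 1)"
    and f_Mt: "\<forall>u u'. nnz u \<le> s \<longrightarrow> nnz u' \<le> s \<longrightarrow>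
           f u' - f u - (u' - u) \<bullet> gradient f u \<le> 1 / 2 * (norm_Q Mt (u - u'))\<^sup>2"
    and As: "As > 0"
      "\<forall>u u'. nnz u \<le> s \<longrightarrow> nnz u' \<le> s \<longrightarrow> norm (A *v (u - u')) \<le> As * norm (u - u')"
    and \<theta>12: "\<theta>1 > 0" "\<theta>2 > 0"
    and \<eta>: "\<eta> > 0"
    and \<mu>: "(\<exists>\<mu>bar>0. \<forall>t. \<mu> t = \<mu>bar) \<or> (\<exists>t0\<ge>1. \<forall>t. \<mu> t = \<eta> / (real t + t0))"
    and alg: "spgm_bcd M f h A b s Mt \<theta>1 \<theta>2 k \<mu> x1 B x y"
    and \<theta>: "\<theta> = \<theta>1 / \<mu> 1 + \<theta>2"
  shows
    "(\<forall>t\<ge>1.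
        (\<integral>\<omega>. \<theta> / 2 * (norm (x (t + 1) \<omega> - x t \<omega>))\<^sup>2
              + 1 / (2 * \<mu> 1) * (norm (y (t + 1) \<omega> - y t \<omega>))\<^sup>2 \<partial>M)
        \<le> Psi Lh \<mu> t + mean_merit M f h A b s \<mu> x y t - mean_merit M f h A b s \<mu> x y (t + 1))
   \<and> (\<forall>t\<ge>1. (\<forall>\<omega>\<in>space M. \<bar>Jfun f h A b s (x t \<omega>) (y t \<omega>) (\<mu> (t - 1))\<bar> \<noteq> \<infinity>) \<and>
        integrable M (\<lambda>\<omega>. real_of_ereal (Jfun f h A b s (x t \<omega>) (y t \<omega>) (\<mu> (t - 1)))))
   \<and> (\<forall>T\<ge>1.
        (\<integral>\<omega>. (\<Sum>t=1..T. (\<theta> / 2 * (norm (x (t + 1) \<omega> - x t \<omega>))\<^sup>2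
              + 1 / (2 * \<mu> 1) * (norm (y (t + 1) \<omega> - y t \<omega>))\<^sup>2)) \<partial>M)
        \<le> Cconst M f h A b s \<mu> x y \<eta> Lh T)
   \<and> (\<forall>\<epsilon>>0. \<forall>T\<ge>1.
        real T \<ge> 2 * Cconst M f h A b s \<mu> x y \<eta> Lh T / (\<epsilon> * min \<theta> (1 / \<mu> 0)) \<longrightarrow>
        (\<exists>t\<in>{1..T}.
           (\<integral>\<^sup>+\<omega>. stationarity f h A b s Mt \<theta>1 \<theta>2 k (x t \<omega>) (y t \<omega>) (\<mu> t) \<partial>M) \<le> ennreal \<epsilon>))
   \<and> (\<exists>Tmin :: real \<Rightarrow> nat.
        (\<forall>\<epsilon>>0. Tmin \<epsilon> \<ge> 1 \<and>
           real (Tmin \<epsilon>) \<ge> 2 * Cconst M f h A b s \<mu> x y \<eta> Lh (Tmin \<epsilon>) / (\<epsilon> * min \<theta> (1 / \<mu> 0)))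
        \<and> (\<lambda>\<epsilon>. real (Tmin \<epsilon>)) \<in> O[at_right 0](\<lambda>\<epsilon>. 1 / \<epsilon>))"
proof -
  define m where "m = min \<theta> (1 / \<mu> 0)"
  define merit where "merit t \<omega> = Rfun f A b (x t \<omega>) (y t \<omega>) (\<mu> (t - 1)) + h (y t \<omega>)" for t \<omega>
  define E where "E t \<omega> = \<theta> / 2 * (norm (x (t + 1) \<omega> - x t \<omega>))\<^sup>2
              + 1 / (2 * \<mu> 1) * (norm (y (t + 1) \<omega> - y t \<omega>))\<^sup>2" for t \<omega>
  define mm where "mm t = mean_merit M f h A b s \<mu> x y t" for t
  define C where "C T = Cconst M f h A b s \<mu> x y \<eta> Lh T" for T
  interpret prob_space M using alg by (simp add: spgm_bcd_def)
  have indep: "indep_vars (\<lambda>_. count_space UNIV) B {1..}"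
    and distr_B: "\<And>t. t \<ge> 1 \<Longrightarrow> distr M (count_space UNIV) (B t) = measure_pmf (pmf_of_set (working_sets k))"
    and x1: "nnz x1 \<le> s"
    and init: "\<And>\<omega>. \<omega> \<in> space M \<Longrightarrow> x 1 \<omega> = x1 \<and> y 1 \<omega> \<in> prox h (\<mu> 0) (A *v x1 - b)"
    and x_step: "\<And>t \<omega>. t \<ge> 1 \<Longrightarrow> \<omega> \<in> space M \<Longrightarrow>
        x (t + 1) \<omega> \<in> argmins (\<lambda>z. major f A b Mt \<theta>1 \<theta>2 z (x t \<omega>) (y t \<omega>) (\<mu> t))
                              {z. nnz z \<le> s \<and> (\<forall>i. i \<notin> B t \<omega> \<longrightarrow> z $ i = x t \<omega> $ i)}"
    and y_step: "\<And>t \<omega>. t \<ge> 1 \<Longrightarrow> \<omega> \<in> space M \<Longrightarrow> y (t + 1) \<omega> \<in> prox h (\<mu> t) (A *v x (t + 1) \<omega> - b)"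
    and det: "\<And>t \<omega> \<omega>'. t \<ge> 1 \<Longrightarrow> \<omega> \<in> space M \<Longrightarrow> \<omega>' \<in> space M \<Longrightarrow>
        (\<forall>i\<in>{1..<t}. B i \<omega> = B i \<omega>') \<Longrightarrow> x t \<omega> = x t \<omega>' \<and> y t \<omega> = y t \<omega>'"
    using alg unfolding spgm_bcd_def by blast+
  note \<mu>_pos = penalty_pos[OF \<mu> \<eta>] and \<mu>_anti = penalty_antimono[OF \<mu> \<eta>]
  have Mt_nonneg: "0 \<le> v \<bullet> (Mt *v v)" for v
    using loewner_ge_scaled_identity[OF Mt(2), of v] Vs_Ms(1)
    by (meson order_trans zero_le_mult_iff less_imp_le zero_le_power2)
  have sparse: "nnz (x t \<omega>) \<le> s" and y_prox: "y t \<omega> \<in> prox h (\<mu> (t - 1)) (A *v x t \<omega> - b)"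
    if "t \<ge> 1" "\<omega> \<in> space M" for t \<omega>
  proof -
    have "nnz (x t \<omega>) \<le> s \<and> y t \<omega> \<in> prox h (\<mu> (t - 1)) (A *v x t \<omega> - b)"
    proof (cases "t = 1")
      case True
      then show ?thesis using init[OF that(2)] x1 by simp
    next
      case False
      define t' where "t' = t - 1"
      have t': "t' \<ge> 1" "t = t' + 1" using False that(1) by (auto simp: t'_def)
      show ?thesis using x_step[OF t'(1) that(2)] y_step[OF t'(1) that(2)]
        by (simp add: t'(2) argmins_def is_arg_min_linorder)
    qed
    then show "nnz (x t \<omega>) \<le> s" "y t \<omega> \<in> prox h (\<mu> (t - 1)) (A *v x t \<omega> - b)" by auto
  qed
  have merit: "Jfun f h A b s (x t \<omega>) (y t \<omega>) (\<mu> (t - 1)) = ereal (merit t \<omega>)"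
    if "t \<ge> 1" "\<omega> \<in> space M" for t \<omega>
    using sparse[OF that] by (simp add: merit_eq merit_def)
  \<comment> \<open>real-valued quantities of iteration \<open>t\<close> are functions of the draws up to \<open>t\<close>, hence integrable\<close>
  have det_step: "x t \<omega> = x t \<omega>' \<and> y t \<omega> = y t \<omega>' \<and> x (t + 1) \<omega> = x (t + 1) \<omega>' \<and> y (t + 1) \<omega> = y (t + 1) \<omega>'"
    if "t \<ge> 1" "\<omega> \<in> space M" "\<omega>' \<in> space M" "\<forall>i\<in>{1..<t + 1}. B i \<omega> = B i \<omega>'" for t \<omega> \<omega>'
    using that det[of t \<omega> \<omega>'] det[of "t + 1" \<omega> \<omega>'] by auto
  have integrable_E: "integrable M (E t)" if "t \<ge> 1" for t
    unfolding E_def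
    by (rule integrable_function_of_history[OF indep, where t = "t + 1"],
        intro ballI impI, drule (2) det_step[OF that], simp)
  have integrable_dx: "integrable M (\<lambda>\<omega>. (norm (x (t + 1) \<omega> - x t \<omega>))\<^sup>2)" if "t \<ge> 1" for t
    by (rule integrable_function_of_history[OF indep, where t = "t + 1"],
        intro ballI impI, drule (2) det_step[OF that], simp)
  have integrable_merit: "integrable M (merit t)" if "t \<ge> 1" for t
    unfolding merit_def
    by (rule integrable_function_of_history[OF indep, where t = t],
        intro ballI impI, drule (2) det[OF that], simp)
  have mm: "mm t = (\<integral>\<omega>. merit t \<omega> \<partial>M)" if "t \<ge> 1" for t
    unfolding mm_def mean_merit_def using that
    by (intro Bochner_Integration.integral_cong) (auto simp: merit simp del: One_nat_def)

  \<comment> \<open>the constants in \<open>E\<close> belong to \<open>\<mu> 1\<close>; as the parameters decrease, each step gains at least as much\<close>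
  have descent_path: "E t \<omega> \<le> Psi Lh \<mu> t + merit t \<omega> - merit (t + 1) \<omega>" if t: "t \<ge> 1" and \<omega>: "\<omega> \<in> space M" for t \<omega>
  proof -
    have "\<theta> \<le> \<theta>1 / \<mu> t + \<theta>2" "1 / (2 * \<mu> 1) \<le> 1 / (2 * \<mu> t)"
      unfolding \<theta> using \<mu>_anti[of 1 t] \<mu>_pos \<theta>12 t by (auto intro!: divide_left_mono mult_pos_pos)
    then have "E t \<omega> \<le> (\<theta>1 / \<mu> t + \<theta>2) / 2 * (norm (x (t + 1) \<omega> - x t \<omega>))\<^sup>2
        + 1 / (2 * \<mu> t) * (norm (y (t + 1) \<omega> - y t \<omega>))\<^sup>2"
      unfolding E_def by (intro add_mono mult_right_mono) auto
    moreover have "merit (t + 1) \<omega> + (\<theta>1 / \<mu> t + \<theta>2) / 2 * (norm (x (t + 1) \<omega> - x t \<omega>))\<^sup>2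
        + 1 / (2 * \<mu> t) * (norm (y (t + 1) \<omega> - y t \<omega>))\<^sup>2
        \<le> Rfun f A b (x t \<omega>) (y t \<omega>) (\<mu> t) + h (y t \<omega>)"
      unfolding merit_def add_diff_cancel_right'
      by (rule descent_step[OF f(1) h Mt_nonneg f_Mt[rule_format] \<mu>_pos \<theta>12
            sparse[OF t \<omega>] x_step[OF t \<omega>] y_step[OF t \<omega>]])
    moreover have "Rfun f A b (x t \<omega>) (y t \<omega>) (\<mu> t) + h (y t \<omega>) \<le> merit t \<omega> + Psi Lh \<mu> t"
      using merit_penalty_change[OF h h_subgrad \<mu>_pos \<mu>_anti y_prox[OF t \<omega>], where f = f] t
      by (simp add: merit_def Psi_def)
    ultimately show ?thesis by linarith
  qed
  have descent: "(\<integral>\<omega>. E t \<omega> \<partial>M) \<le> Psi Lh \<mu> t + mm t - mm (t + 1)" if "t \<ge> 1" for t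
  proof -
    have "(\<integral>\<omega>. E t \<omega> \<partial>M) \<le> (\<integral>\<omega>. Psi Lh \<mu> t + merit t \<omega> - merit (t + 1) \<omega> \<partial>M)"
      using that descent_path
      by (intro integral_mono integrable_E Bochner_Integration.integrable_diff
          Bochner_Integration.integrable_add integrable_merit) auto
    also have "\<dots> = Psi Lh \<mu> t + mm t - mm (t + 1)"
      using that integrable_merit[of t] integrable_merit[of "t + 1"] by (simp add: mm prob_space)
    finally show ?thesis .
  qed
  have telescope: "(\<Sum>t=1..T. mm t - mm (t + 1)) = mm 1 - mm (T + 1)" for T
    by (induction T) simp_all
  have C: "C T = mm 1 - mm (T + 1) + \<eta> * Lh\<^sup>2" for T
    by (simp add: C_def Cconst_def mm_def)
  have total: "(\<integral>\<omega>. (\<Sum>t=1..T. E t \<omega>) \<partial>M) \<le> C T" for T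
  proof -
    have "(\<integral>\<omega>. (\<Sum>t=1..T. E t \<omega>) \<partial>M) = (\<Sum>t=1..T. \<integral>\<omega>. E t \<omega> \<partial>M)"
      by (intro Bochner_Integration.integral_sum integrable_E) auto
    also have "\<dots> \<le> (\<Sum>t=1..T. Psi Lh \<mu> t + (mm t - mm (t + 1)))"
      using descent by (intro sum_mono) (simp add: algebra_simps)
    also have "\<dots> = (\<Sum>t=1..T. Psi Lh \<mu> t) + (mm 1 - mm (T + 1))"
      by (simp only: sum.distrib telescope)
    also have "\<dots> \<le> C T"
      using penalty_budget[OF \<mu> \<eta>, of 0 Lh T] \<mu>_pos[of 0] by (simp add: C)
    finally show ?thesis .
  qed

  have m: "m > 0" "m \<le> \<theta>" "m \<le> 1 / \<mu> 0"
    using \<theta>12 \<mu>_pos by (auto simp: m_def \<theta> intro!: add_pos_pos)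
  \<comment> \<open>\<open>r t\<close> bounds the expected stationarity: the movement of the proximal point under the change of
    parameter, plus the expected squared step\<close>
  define r where "r t = (Lh * (\<mu> (t - 1) - \<mu> t))\<^sup>2 + (\<integral>\<omega>. (norm (x (t + 1) \<omega> - x t \<omega>))\<^sup>2 \<partial>M)" for t
  have stat: "(\<integral>\<^sup>+\<omega>. stationarity f h A b s Mt \<theta>1 \<theta>2 k (x t \<omega>) (y t \<omega>) (\<mu> t) \<partial>M) \<le> ennreal (r t)"
    if t: "t \<ge> 1" for t
  proof -
    let ?W = "working_sets k :: 'n set set"
    let ?gap = "\<lambda>b' \<omega>. block_gap f A b s Mt \<theta>1 \<theta>2 b' (x t \<omega>) (y t \<omega>) (\<mu> t)"
    let ?avg = "\<lambda>\<omega>. 1 / of_nat (card ?W) * (\<Sum>B\<in>?W. ?gap B \<omega>)"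
    let ?c = "ennreal ((Lh * (\<mu> (t - 1) - \<mu> t))\<^sup>2)"
    have W: "?W \<noteq> {}"
      using obtain_subset_with_card_n[OF k(2)] by (auto simp: working_sets_def)
    have "?avg \<in> borel_measurable M"
      by (rule borel_measurable_function_of_history[OF indep, where t = t],
          intro ballI impI, drule (2) det[OF t], simp)
    then have "(\<integral>\<^sup>+\<omega>. ?c + ?avg \<omega> \<partial>M) = ?c + (\<integral>\<^sup>+\<omega>. ?avg \<omega> \<partial>M)"
      by (subst nn_integral_add) (auto simp: emeasure_space_1)
    also have "(\<integral>\<^sup>+\<omega>. ?avg \<omega> \<partial>M) = (\<integral>\<^sup>+\<omega>. ?gap (B t \<omega>) \<omega> \<partial>M)"
    proof (rule uniform_draw_average[OF indep t distr_B[OF t] W])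
      show "\<forall>\<omega>\<in>space M. \<forall>\<omega>'\<in>space M. (\<forall>i\<in>{1..<t}. B i \<omega> = B i \<omega>') \<longrightarrow> ?gap b' \<omega> = ?gap b' \<omega>'" for b'
        using det[OF t] by metis
    qed
    also have "\<dots> \<le> (\<integral>\<^sup>+\<omega>. ennreal ((norm (x (t + 1) \<omega> - x t \<omega>))\<^sup>2) \<partial>M)"
      by (intro nn_integral_mono block_gap_le_step x_step t)
    also have "\<dots> = ennreal (\<integral>\<omega>. (norm (x (t + 1) \<omega> - x t \<omega>))\<^sup>2 \<partial>M)"
      by (intro nn_integral_eq_integral integrable_dx t) auto
    also have "?c + \<dots> = ennreal (r t)"
      unfolding r_def by (intro ennreal_plus[symmetric] integral_nonneg) auto
    finally have "(\<integral>\<^sup>+\<omega>. ?c + ?avg \<omega> \<partial>M) \<le> ennreal (r t)" by simp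
    moreover have "(\<integral>\<^sup>+\<omega>. stationarity f h A b s Mt \<theta>1 \<theta>2 k (x t \<omega>) (y t \<omega>) (\<mu> t) \<partial>M) \<le> (\<integral>\<^sup>+\<omega>. ?c + ?avg \<omega> \<partial>M)"
      using t by (intro nn_integral_mono stationarity_le h h_subgrad \<mu>_pos \<mu>_anti sparse y_prox) auto
    ultimately show ?thesis by (rule order_trans[rotated])
  qed
  have sum_r: "m / 2 * (\<Sum>t=1..T. r t) \<le> C T" for T
  proof -
    have "m / 2 * r t \<le> (Psi Lh \<mu> t + m / 2 * (Lh * (\<mu> (t - 1) - \<mu> t))\<^sup>2) + (mm t - mm (t + 1))"
      if t: "t \<ge> 1" for t
    proof -
      have "m / 2 * (\<integral>\<omega>. (norm (x (t + 1) \<omega> - x t \<omega>))\<^sup>2 \<partial>M) = (\<integral>\<omega>. m / 2 * (norm (x (t + 1) \<omega> - x t \<omega>))\<^sup>2 \<partial>M)"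
        by simp
      also have "\<dots> \<le> (\<integral>\<omega>. E t \<omega> \<partial>M)"
      proof (intro integral_mono integrable_E integrable_mult_right integrable_dx t)
        fix \<omega>
        have "0 \<le> 1 / (2 * \<mu> 1) * (norm (y (t + 1) \<omega> - y t \<omega>))\<^sup>2" using \<mu>_pos[of 1] by simp
        moreover have "m / 2 * (norm (x (t + 1) \<omega> - x t \<omega>))\<^sup>2 \<le> \<theta> / 2 * (norm (x (t + 1) \<omega> - x t \<omega>))\<^sup>2"
          using m by (intro mult_right_mono) auto
        ultimately show "m / 2 * (norm (x (t + 1) \<omega> - x t \<omega>))\<^sup>2 \<le> E t \<omega>" by (simp add: E_def)
      qed
      finally show ?thesis using descent[OF t] unfolding r_def distrib_left by linarith
    qed
    then have "(\<Sum>t=1..T. m / 2 * r t) \<le>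
        (\<Sum>t=1..T. (Psi Lh \<mu> t + m / 2 * (Lh * (\<mu> (t - 1) - \<mu> t))\<^sup>2) + (mm t - mm (t + 1)))"
      by (intro sum_mono) auto
    also have "\<dots> = (\<Sum>t=1..T. Psi Lh \<mu> t + m / 2 * (Lh * (\<mu> (t - 1) - \<mu> t))\<^sup>2) + (mm 1 - mm (T + 1))"
      by (subst sum.distrib) (simp only: telescope)
    also have "\<dots> \<le> C T"
      using penalty_budget[OF \<mu> \<eta>, of m Lh T] m by (simp add: C)
    finally show ?thesis by (simp add: sum_distrib_left)
  qed
  have stationary: "\<exists>t\<in>{1..T}.
      (\<integral>\<^sup>+\<omega>. stationarity f h A b s Mt \<theta>1 \<theta>2 k (x t \<omega>) (y t \<omega>) (\<mu> t) \<partial>M) \<le> ennreal \<epsilon>"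
    if \<epsilon>: "\<epsilon> > 0" and T: "T \<ge> 1" "real T \<ge> 2 * C T / (\<epsilon> * m)" for \<epsilon> T
  proof -
    have "\<exists>t\<in>{1..T}. r t \<le> \<epsilon>"
    proof (rule ccontr)
      assume "\<not> (\<exists>t\<in>{1..T}. r t \<le> \<epsilon>)"
      then have "\<And>t. t \<in> {1..T} \<Longrightarrow> \<epsilon> < r t" by (meson not_le)
      then have "(\<Sum>t=1..T. \<epsilon>) < (\<Sum>t=1..T. r t)" using T(1) by (intro sum_strict_mono) auto
      then have "m / 2 * (real T * \<epsilon>) < m / 2 * (\<Sum>t=1..T. r t)"
        using m by (intro mult_strict_left_mono) auto
      also have "\<dots> \<le> C T" by (rule sum_r)
      finally show False using T(2) m \<epsilon> by (simp add: field_simps)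
    qed
    then obtain t where "t \<in> {1..T}" "r t \<le> \<epsilon>" by blast
    then show ?thesis using stat[of t] ennreal_leI[of "r t" \<epsilon>] by (intro bexI[of _ t]) (auto intro: order_trans)
  qed

  \<comment> \<open>a subgradient of \<open>h\<close>, read off from the initial proximal point, and strong convexity of \<open>f\<close> between
    \<open>0\<close> and sparse vectors bound all mean merit values from below\<close>
  obtain \<omega>0 where \<omega>0: "\<omega>0 \<in> space M" using not_empty by blast
  have "f 0 + u \<bullet> gradient f 0 + Vs / 2 * (norm u)\<^sup>2 \<le> f u" if "nnz u \<le> s" for u
  proof -
    have "nnz (0 :: real^'n) \<le> s" by (simp add: nnz_def)
    from f_bounds[rule_format, OF this that] show ?thesis by simp
  qed
  from merit_bounded_below[OF Vs_Ms(1) this prox_subgradient[OF h \<mu>_pos y_prox[OF order_refl \<omega>0]],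
      where A = A and b = b and \<mu>max = "\<mu> 0"]
  obtain c where c: "\<And>u w \<mu>'. nnz u \<le> s \<Longrightarrow> 0 < \<mu>' \<Longrightarrow> \<mu>' \<le> \<mu> 0 \<Longrightarrow> c \<le> Rfun f A b u w \<mu>' + h w"
    by blast
  have mm_ge: "c \<le> mm t" if "t \<ge> 1" for t
  proof -
    have "(\<integral>\<omega>. c \<partial>M) \<le> (\<integral>\<omega>. merit t \<omega> \<partial>M)"
      using that \<mu>_pos \<mu>_anti
      by (intro integral_mono integrable_merit) (auto simp: merit_def intro!: c sparse)
    then show ?thesis using that by (simp add: mm prob_space)
  qed
  define K where "K = mm 1 - c + \<eta> * Lh\<^sup>2"
  have K: "K \<ge> 0" "\<And>T. C T \<le> K"
    using mm_ge \<eta> by (auto simp: K_def C)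
  define Tmin where "Tmin \<epsilon> = nat \<lceil>2 * K / (\<epsilon> * m)\<rceil> + 1" for \<epsilon>
  have "Tmin \<epsilon> \<ge> 1 \<and> real (Tmin \<epsilon>) \<ge> 2 * C (Tmin \<epsilon>) / (\<epsilon> * m)" if "\<epsilon> > 0" for \<epsilon>
  proof -
    have "2 * C (Tmin \<epsilon>) / (\<epsilon> * m) \<le> 2 * K / (\<epsilon> * m)"
      using K m that by (intro divide_right_mono) auto
    also have "\<dots> \<le> real (Tmin \<epsilon>)" unfolding Tmin_def by linarith
    finally show ?thesis by (simp add: Tmin_def)
  qed
  moreover have "(\<lambda>\<epsilon>. real (Tmin \<epsilon>)) \<in> O[at_right 0](\<lambda>\<epsilon>. 1 / \<epsilon>)"
  proof (rule bigoI)
    show "\<forall>\<^sub>F \<epsilon> in at_right 0. norm (real (Tmin \<epsilon>)) \<le> (2 * K / m + 2) * norm (1 / \<epsilon>)"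
      using eventually_at_right_real[of 0 "1::real"]
    proof (rule eventually_mono)
      fix \<epsilon> :: real assume \<epsilon>: "\<epsilon> \<in> {0<..<1}"
      have "0 \<le> 2 * K / (\<epsilon> * m)" using K m \<epsilon> by simp
      then have "real (Tmin \<epsilon>) \<le> 2 * K / (\<epsilon> * m) + 2" unfolding Tmin_def by linarith
      also have "\<dots> \<le> 2 * K / (\<epsilon> * m) + 2 / \<epsilon>" using \<epsilon> by (simp add: field_simps)
      also have "\<dots> = (2 * K / m + 2) * (1 / \<epsilon>)" using \<epsilon> m by (simp add: field_simps)
      finally show "norm (real (Tmin \<epsilon>)) \<le> (2 * K / m + 2) * norm (1 / \<epsilon>)" using \<epsilon> by simp
    qed simp
  qed
  ultimately have Tmin: "\<exists>Tmin :: real \<Rightarrow> nat.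
      (\<forall>\<epsilon>>0. Tmin \<epsilon> \<ge> 1 \<and> real (Tmin \<epsilon>) \<ge> 2 * C (Tmin \<epsilon>) / (\<epsilon> * m))
      \<and> (\<lambda>\<epsilon>. real (Tmin \<epsilon>)) \<in> O[at_right 0](\<lambda>\<epsilon>. 1 / \<epsilon>)" by blast

  have finite_merit: "\<forall>t\<ge>1. (\<forall>\<omega>\<in>space M. \<bar>Jfun f h A b s (x t \<omega>) (y t \<omega>) (\<mu> (t - 1))\<bar> \<noteq> \<infinity>) \<and>
      integrable M (\<lambda>\<omega>. real_of_ereal (Jfun f h A b s (x t \<omega>) (y t \<omega>) (\<mu> (t - 1))))"
  proof (intro allI impI conjI ballI)
    fix t :: nat assume t: "t \<ge> 1"
    show "integrable M (\<lambda>\<omega>. real_of_ereal (Jfun f h A b s (x t \<omega>) (y t \<omega>) (\<mu> (t - 1))))"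
      using integrable_merit[OF t] t
      by (subst Bochner_Integration.integrable_cong[OF refl, where g = "merit t"]) (auto simp: merit simp del: One_nat_def)
  qed (simp add: merit del: One_nat_def)
  show ?thesis
    using descent total finite_merit stationary Tmin
    unfolding E_def mm_def C_def m_def by blast
qed

end
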